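(* Let $K$ be a field, $Q$ a finite quiver, $\mathcal B$ the set of finite directed paths of $Q$, and $\succ$ an admissible order on $\mathcal B$. Suppose that $\mathcal T\subset\mathcal B$ is a finite tip-reduced set of paths of length at least $2$ and that $\mathcal N(t)$ is a finite set for all $t\in\mathcal T$. Then $\mathcal V_{\mathcal T}$ is an affine algebraic variety, i.e. it is the zero set in $K^D$ of a set of polynomials in $K[x_{t,n}\mid t\in\mathcal T,\ n\in\mathcal N(t)]$.
   Context: Vertices of $Q$ are regarded as paths of length $0$ in $\mathcal B$; paths are read left to right. For $p,q\in\mathcal B$, $p$ is a subpath of $q$ if $q=rps$ for some $r,s\in\mathcal B$. An admissible order $\succ$ on $\mathcal B$ is a well-order such that: if $p\succ q$ then $pr\succ qr$ whenever $pr,qr$ are nonzero, and $sp\succ sq$ whenever $sp,sq$ are nonzero; and if $p=rqs\neq0$ then $p\succeq q$. For $0\ne x=\sum_p\alpha_pp\in KQ$, $\mathrm{tip}(x)$ is the $\succ$-largest $p$ with $\alpha_p\neq0$; $\mathrm{tip}(X)=\{\mathrm{tip}(x)\mid 0\neq x\in X\}$. A set $X$ is tip-reduced if for distinct nonzero $x,y\in X$, $\mathrm{tip}(x)$ is not a subpath of $\mathrm{tip}(y)$. Paths are parallel, $p\|q$, if they have the same origin and the same terminus vertices. All ideals are two-sided. For an ideal $I$ put $I_{Mon}=\langle\mathrm{tip}(I)\rangle$. There is a unique minimal set $\mathcal T_I$ of paths generating $I_{Mon}$, and for each $t\in\mathcal T_I$ there is a unique $g_t\in I$ with $t-g_t\in\mathrm{Span}_K(\mathcal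 B\setminus\mathrm{tip}(I))$; the set $\{g_t\mid t\in\mathcal T_I\}$ is the reduced Gröbner basis of $I$. Let $\mathcal N$ be the set of paths having no element of $\mathcal T$ as a subpath, and for $t\in\mathcal T$ let $\mathcal N(t)=\{n\in\mathcal N\mid n\|t,\ t\succ n\}$, $D=\sum_{t\in\mathcal T}|\mathcal N(t)|$. For $\mathbf c=(c_{t,n})\in K^D$ ($t\in\mathcal T$, $n\in\mathcal N(t)$) let $\mathcal G_{\mathbf c}=\{t-\sum_{n\in\mathcal N(t)}c_{t,n}n\mid t\in\mathcal T\}$. Then $\mathcal V_{\mathcal T}=\{\mathbf c\in K^D\mid \mathcal G_{\mathbf c}\text{ is the reduced Gröbner basis of }\langle\mathcal G_{\mathbf c}\rangle\}$. *)

theory Defs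
  imports
    "Graph_Theory.Arc_Walk"
    "HOL-Algebra.Ideal"
    "HOL-Library.Poly_Mapping"
    "HOL-Library.FuncSet"
begin

section \<open>Paths in a quiver\<close>

text \<open>
  A finite quiver is a \<^locale>\<open>fin_digraph\<close>, which allows loops and parallel arcs. A path is a triple
  (origin, list of arcs, terminus); the paths of length 0 are the triples \<open>(v, [], v)\<close>.
\<close>

type_synonym ('v, 'e) qpath = "'v \<times> 'e list \<times> 'v"

definition origin :: "('v, 'e) qpath \<Rightarrow> 'v" where
  "origin p = fst p"

definition path_arcs :: "('v, 'e) qpath \<Rightarrow> 'e list" where
  "path_arcs p = fst (snd p)"

definition terminus :: "('v, 'e) qpath \<Rightarrow> 'v" where
  "terminus p = snd (snd p)"

definition path_length :: "('v, 'e) qpath \<Rightarrow> nat" where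
  "path_length p = length (path_arcs p)"

definition qpaths :: "('v, 'e) pre_digraph \<Rightarrow> ('v, 'e) qpath set" where
  "qpaths Q = {p. pre_digraph.awalk Q (origin p) (path_arcs p) (terminus p)}"

text \<open>
  The product of the paths \<open>p\<close> and \<open>q\<close> in the path algebra is nonzero iff \<open>composable p q\<close>,
  and then it is the path \<open>concat_path p q\<close>.
\<close>

definition composable :: "('v, 'e) qpath \<Rightarrow> ('v, 'e) qpath \<Rightarrow> bool" where
  "composable p q \<longleftrightarrow> terminus p = origin q"

definition concat_path :: "('v, 'e) qpath \<Rightarrow> ('v, 'e) qpath \<Rightarrow> ('v, 'e) qpath" where
  "concat_path p q = (origin p, path_arcs p @ path_arcs q, terminus q)"

definition parallel :: "('v, 'e) qpath \<Rightarrow> ('v, 'e) qpath \<Rightarrow> bool" where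
  "parallel p q \<longleftrightarrow> origin p = origin q \<and> terminus p = terminus q"

definition subpath :: "('v, 'e) pre_digraph \<Rightarrow> ('v, 'e) qpath \<Rightarrow> ('v, 'e) qpath \<Rightarrow> bool" where
  "subpath Q p q \<longleftrightarrow> (\<exists>a\<in>qpaths Q. \<exists>b\<in>qpaths Q.
     composable a p \<and> composable p b \<and> q = concat_path (concat_path a p) b)"


section \<open>Admissible orders\<close>

text \<open>
  As usual in HOL, an order is a reflexive relation \<open>r\<close> with \<open>(q, p) \<in> r\<close> meaning \<open>q \<preceq> p\<close>.
\<close>

definition path_gt ::
  "('v, 'e) qpath rel \<Rightarrow> ('v, 'e) qpath \<Rightarrow> ('v, 'e) qpath \<Rightarrow> bool" where
  "path_gt r p q \<longleftrightarrow> (q, p) \<in> r \<and> p \<noteq> q"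

definition admissible_order :: "('v, 'e) pre_digraph \<Rightarrow> ('v, 'e) qpath rel \<Rightarrow> bool" where
  "admissible_order Q r \<longleftrightarrow>
     well_order_on (qpaths Q) r \<and>
     (\<forall>p\<in>qpaths Q. \<forall>q\<in>qpaths Q. \<forall>s\<in>qpaths Q. path_gt r p q \<longrightarrow>
        composable p s \<longrightarrow> composable q s \<longrightarrow> path_gt r (concat_path p s) (concat_path q s)) \<and>
     (\<forall>p\<in>qpaths Q. \<forall>q\<in>qpaths Q. \<forall>s\<in>qpaths Q. path_gt r p q \<longrightarrow>
        composable s p \<longrightarrow> composable s q \<longrightarrow> path_gt r (concat_path s p) (concat_path s q)) \<and>
     (\<forall>p\<in>qpaths Q. \<forall>q\<in>qpaths Q. subpath Q q p \<longrightarrow> (q, p) \<in> r)"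


section \<open>The path algebra\<close>

definition path_elem :: "('v, 'e) qpath \<Rightarrow> (('v, 'e) qpath \<Rightarrow>\<^sub>0 'k::field)" where
  "path_elem p = Poly_Mapping.single p 1"

definition path_times ::
  "(('v, 'e) qpath \<Rightarrow>\<^sub>0 'k::field) \<Rightarrow> (('v, 'e) qpath \<Rightarrow>\<^sub>0 'k) \<Rightarrow> (('v, 'e) qpath \<Rightarrow>\<^sub>0 'k)" where
  "path_times x y = (\<Sum>p\<in>Poly_Mapping.keys x. \<Sum>q\<in>Poly_Mapping.keys y.
     if composable p q
     then Poly_Mapping.single (concat_path p q)
            (Poly_Mapping.lookup x p * Poly_Mapping.lookup y q)
     else 0)"

definition path_algebra ::
  "('v, 'e) pre_digraph \<Rightarrow> (('v, 'e) qpath \<Rightarrow>\<^sub>0 'k::field) ring" where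
  "path_algebra Q =
     \<lparr>carrier = {x. Poly_Mapping.keys x \<subseteq> qpaths Q},
      mult = path_times,
      one = (\<Sum>v\<in>verts Q. path_elem (v, [], v)),
      zero = 0,
      add = (+)\<rparr>"

definition path_scale ::
  "'k::field \<Rightarrow> (('v, 'e) qpath \<Rightarrow>\<^sub>0 'k) \<Rightarrow> (('v, 'e) qpath \<Rightarrow>\<^sub>0 'k)" where
  "path_scale c x = Poly_Mapping.map ((*) c) x"

definition path_span :: "('v, 'e) qpath set \<Rightarrow> (('v, 'e) qpath \<Rightarrow>\<^sub>0 'k::field) set" where
  "path_span S = module.span path_scale (path_elem ` S)"


section \<open>Tips and reduced Groebner bases\<close>

definition tip :: "('v, 'e) qpath rel \<Rightarrow> (('v, 'e) qpath \<Rightarrow>\<^sub>0 'k::field) \<Rightarrow> ('v, 'e) qpath" where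
  "tip r x = (THE p. p \<in> Poly_Mapping.keys x \<and> (\<forall>q\<in>Poly_Mapping.keys x. (q, p) \<in> r))"

definition tips ::
  "('v, 'e) qpath rel \<Rightarrow> (('v, 'e) qpath \<Rightarrow>\<^sub>0 'k::field) set \<Rightarrow> ('v, 'e) qpath set" where
  "tips r X = tip r ` (X - {0})"

definition tip_reduced ::
  "('v, 'e) pre_digraph \<Rightarrow> ('v, 'e) qpath rel \<Rightarrow> (('v, 'e) qpath \<Rightarrow>\<^sub>0 'k::field) set \<Rightarrow> bool" where
  "tip_reduced Q r X \<longleftrightarrow>
     (\<forall>x\<in>X. \<forall>y\<in>X. x \<noteq> 0 \<longrightarrow> y \<noteq> 0 \<longrightarrow> x \<noteq> y \<longrightarrow> \<not> subpath Q (tip r x) (tip r y))"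

definition mon_ideal ::
  "('v, 'e) pre_digraph \<Rightarrow> ('v, 'e) qpath rel \<Rightarrow> (('v, 'e) qpath \<Rightarrow>\<^sub>0 'k::field) set
    \<Rightarrow> (('v, 'e) qpath \<Rightarrow>\<^sub>0 'k) set" where
  "mon_ideal Q r I = genideal (path_algebra Q) (path_elem ` tips r I)"

definition minimal_path_generators ::
  "('v, 'e) pre_digraph \<Rightarrow> (('v, 'e) qpath \<Rightarrow>\<^sub>0 'k::field) set \<Rightarrow> ('v, 'e) qpath set \<Rightarrow> bool" where
  "minimal_path_generators Q J S \<longleftrightarrow>
     S \<subseteq> qpaths Q \<and> genideal (path_algebra Q) (path_elem ` S) = J \<and>
     (\<forall>S'. S' \<subset> S \<longrightarrow> genideal (path_algebra Q) (path_elem ` S') \<noteq> J)"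

definition min_tips ::
  "('v, 'e) pre_digraph \<Rightarrow> ('v, 'e) qpath rel \<Rightarrow> (('v, 'e) qpath \<Rightarrow>\<^sub>0 'k::field) set
    \<Rightarrow> ('v, 'e) qpath set" where
  "min_tips Q r I = (THE S. minimal_path_generators Q (mon_ideal Q r I) S)"

definition groebner_elem ::
  "('v, 'e) pre_digraph \<Rightarrow> ('v, 'e) qpath rel \<Rightarrow> (('v, 'e) qpath \<Rightarrow>\<^sub>0 'k::field) set
    \<Rightarrow> ('v, 'e) qpath \<Rightarrow> (('v, 'e) qpath \<Rightarrow>\<^sub>0 'k)" where
  "groebner_elem Q r I t =
     (THE g. g \<in> I \<and> path_elem t - g \<in> path_span (qpaths Q - tips r I))"

definition reduced_groebner_basis ::
  "('v, 'e) pre_digraph \<Rightarrow> ('v, 'e) qpath rel \<Rightarrow> (('v, 'e) qpath \<Rightarrow>\<^sub>0 'k::field) set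
    \<Rightarrow> (('v, 'e) qpath \<Rightarrow>\<^sub>0 'k) set" where
  "reduced_groebner_basis Q r I = groebner_elem Q r I ` min_tips Q r I"


section \<open>The set \<open>V\<^sub>T\<close>\<close>

definition normal_paths ::
  "('v, 'e) pre_digraph \<Rightarrow> ('v, 'e) qpath set \<Rightarrow> ('v, 'e) qpath set" where
  "normal_paths Q T = {n \<in> qpaths Q. \<forall>t\<in>T. \<not> subpath Q t n}"

definition normal_below ::
  "('v, 'e) pre_digraph \<Rightarrow> ('v, 'e) qpath rel \<Rightarrow> ('v, 'e) qpath set \<Rightarrow> ('v, 'e) qpath
    \<Rightarrow> ('v, 'e) qpath set" where
  "normal_below Q r T t = {n \<in> normal_paths Q T. parallel n t \<and> path_gt r t n}"

text \<open>
  The index set of the coordinates. With finite \<open>T\<close> and finite \<open>normal_below Q r T t\<close> it has \<open>D\<close>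
  elements, and \<open>K\<^sup>D\<close> is the set of functions \<open>coord_index Q r T \<rightarrow>\<^sub>E UNIV\<close>.
\<close>

definition coord_index ::
  "('v, 'e) pre_digraph \<Rightarrow> ('v, 'e) qpath rel \<Rightarrow> ('v, 'e) qpath set
    \<Rightarrow> (('v, 'e) qpath \<times> ('v, 'e) qpath) set" where
  "coord_index Q r T = (SIGMA t:T. normal_below Q r T t)"

definition G_of ::
  "('v, 'e) pre_digraph \<Rightarrow> ('v, 'e) qpath rel \<Rightarrow> ('v, 'e) qpath set
    \<Rightarrow> (('v, 'e) qpath \<times> ('v, 'e) qpath \<Rightarrow> 'k::field) \<Rightarrow> (('v, 'e) qpath \<Rightarrow>\<^sub>0 'k) set" where
  "G_of Q r T c =
     (\<lambda>t. path_elem t - (\<Sum>n\<in>normal_below Q r T t. path_scale (c (t, n)) (path_elem n))) ` T"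

definition V_of ::
  "('v, 'e) pre_digraph \<Rightarrow> ('v, 'e) qpath rel \<Rightarrow> ('v, 'e) qpath set
    \<Rightarrow> (('v, 'e) qpath \<times> ('v, 'e) qpath \<Rightarrow> 'k::field) set" where
  "V_of Q r T = {c \<in> coord_index Q r T \<rightarrow>\<^sub>E UNIV.
     G_of Q r T c = reduced_groebner_basis Q r (genideal (path_algebra Q) (G_of Q r T c))}"


section \<open>Affine varieties\<close>

text \<open>
  Polynomials in variables of type \<open>'x\<close> over \<open>'k\<close> have the type \<open>('x \<Rightarrow>\<^sub>0 nat) \<Rightarrow>\<^sub>0 'k\<close>: finitely
  supported maps from monomials to coefficients. The ring \<open>K[x\<^sub>i | i \<in> X]\<close> consists of those with
  \<open>mpoly_vars f \<subseteq> X\<close>.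
\<close>

definition mpoly_vars :: "(('x \<Rightarrow>\<^sub>0 nat) \<Rightarrow>\<^sub>0 'k::zero) \<Rightarrow> 'x set" where
  "mpoly_vars f = (\<Union>m\<in>Poly_Mapping.keys f. Poly_Mapping.keys m)"

definition mpoly_eval :: "('x \<Rightarrow> 'k::comm_semiring_1) \<Rightarrow> (('x \<Rightarrow>\<^sub>0 nat) \<Rightarrow>\<^sub>0 'k) \<Rightarrow> 'k" where
  "mpoly_eval c f = (\<Sum>m\<in>Poly_Mapping.keys f.
     Poly_Mapping.lookup f m * (\<Prod>i\<in>Poly_Mapping.keys m. c i ^ Poly_Mapping.lookup m i))"

definition affine_variety :: "'x set \<Rightarrow> ('x \<Rightarrow> 'k::field) set \<Rightarrow> bool" where
  "affine_variety X V \<longleftrightarrow> (\<exists>F. (\<forall>f\<in>F. mpoly_vars f \<subseteq> X) \<and>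
     V = {c \<in> X \<rightarrow>\<^sub>E UNIV. \<forall>f\<in>F. mpoly_eval c f = 0})"


section \<open>Well-definedness of the algebraic notions\<close>

text \<open>
  \<^const>\<open>genideal\<close> and \<^const>\<open>module.span\<close> are meaningful only over an actual ring and an actual
  module, respectively; the following facts provide this.
\<close>

lemma path_proj [simp]:
  "origin (concat_path p q) = origin p"
  "terminus (concat_path p q) = terminus q"
  "path_arcs (concat_path p q) = path_arcs p @ path_arcs q"
  by (simp_all add: origin_def terminus_def path_arcs_def concat_path_def)

lemma concat_path_assoc: "concat_path (concat_path p q) s = concat_path p (concat_path q s)"
  by (simp add: concat_path_def origin_def terminus_def path_arcs_def)

lemma concat_path_in_qpaths:
  assumes "wf_digraph Q" "p \<in> qpaths Q" "q \<in> qpaths Q" "composable p q"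
  shows "concat_path p q \<in> qpaths Q"
proof -
  interpret wf_digraph Q by fact
  show ?thesis
    using assms(2-4) by (auto simp: qpaths_def composable_def intro: awalk_appendI)
qed

lemma path_times_superset:
  assumes "finite A" "finite B" "Poly_Mapping.keys x \<subseteq> A" "Poly_Mapping.keys y \<subseteq> B"
  shows "path_times x y = (\<Sum>p\<in>A. \<Sum>q\<in>B.
     if composable p q
     then Poly_Mapping.single (concat_path p q)
            (Poly_Mapping.lookup x p * Poly_Mapping.lookup y q)
     else 0)" (is "_ = (\<Sum>p\<in>A. \<Sum>q\<in>B. ?t p q)")
proof -
  have "(\<Sum>p\<in>A. \<Sum>q\<in>B. ?t p q) = (\<Sum>p\<in>A. \<Sum>q\<in>Poly_Mapping.keys y. ?t p q)"
    by (intro sum.cong sum.mono_neutral_right assms ballI refl) (auto simp: in_keys_iff)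
  also have "\<dots> = path_times x y"
    unfolding path_times_def
    by (intro sum.mono_neutral_right assms ballI sum.neutral) (auto simp: in_keys_iff)
  finally show ?thesis by simp
qed

lemma path_times_add_left: "path_times (x + y) z = path_times x z + path_times y z"
proof -
  let ?A = "Poly_Mapping.keys x \<union> Poly_Mapping.keys y"
  have "Poly_Mapping.keys (x + y) \<subseteq> ?A" by (rule Poly_Mapping.keys_add)
  then show ?thesis
    by (subst (1 2 3) path_times_superset[where A = ?A and B = "Poly_Mapping.keys z"])
      (auto simp: sum.distrib[symmetric] lookup_add distrib_right single_add intro!: sum.cong)
qed

lemma path_times_add_right: "path_times z (x + y) = path_times z x + path_times z y"
proof -
  let ?A = "Poly_Mapping.keys x \<union> Poly_Mapping.keys y"
  have "Poly_Mapping.keys (x + y) \<subseteq> ?A" by (rule Poly_Mapping.keys_add)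
  then show ?thesis
    by (subst (1 2 3) path_times_superset[where B = ?A and A = "Poly_Mapping.keys z"])
      (auto simp: sum.distrib[symmetric] lookup_add distrib_left single_add intro!: sum.cong)
qed

lemma path_times_zero [simp]: "path_times 0 x = 0" "path_times x 0 = 0"
  by (simp_all add: path_times_def)

lemma path_times_sum_left: "path_times (\<Sum>i\<in>A. f i) z = (\<Sum>i\<in>A. path_times (f i) z)"
  by (induction A rule: infinite_finite_induct) (simp_all add: path_times_add_left)

lemma path_times_sum_right: "path_times z (\<Sum>i\<in>A. f i) = (\<Sum>i\<in>A. path_times z (f i))"
  by (induction A rule: infinite_finite_induct) (simp_all add: path_times_add_right)

lemma path_times_single:
  "path_times (Poly_Mapping.single p a) (Poly_Mapping.single q b) =
     (if composable p q then Poly_Mapping.single (concat_path p q) (a * b) else 0)"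
  by (subst path_times_superset[where A = "{p}" and B = "{q}"]) auto

lemma path_sum_singles:
  "x = (\<Sum>p\<in>Poly_Mapping.keys x. Poly_Mapping.single p (Poly_Mapping.lookup x p))"
  by (rule poly_mapping_eqI) (auto simp: lookup_sum lookup_single when_def in_keys_iff)

lemma path_times_assoc: "path_times (path_times x y) z = path_times x (path_times y z)"
proof -
  have 1: "path_times (path_times (Poly_Mapping.single p a) (Poly_Mapping.single q b))
      (Poly_Mapping.single s c) =
    path_times (Poly_Mapping.single p a)
      (path_times (Poly_Mapping.single q b) (Poly_Mapping.single s c))"
    for p q s :: "('a, 'b) qpath" and a b c :: 'c
    by (simp add: path_times_single composable_def concat_path_assoc mult.assoc)
  show ?thesis
    apply (subst (1 2) path_sum_singles[of x], subst (1 2) path_sum_singles[of y],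
        subst (1 2) path_sum_singles[of z])
    apply (simp only: path_times_sum_left path_times_sum_right 1)
    done
qed

lemma path_times_closed:
  assumes "wf_digraph Q" "Poly_Mapping.keys x \<subseteq> qpaths Q" "Poly_Mapping.keys y \<subseteq> qpaths Q"
  shows "Poly_Mapping.keys (path_times x y) \<subseteq> qpaths Q"
proof -
  have *: "Poly_Mapping.keys (if composable p q then Poly_Mapping.single (concat_path p q) c else 0)
      \<subseteq> qpaths Q"
    if "p \<in> Poly_Mapping.keys x" "q \<in> Poly_Mapping.keys y" for p q c
    using that assms concat_path_in_qpaths[of Q p q] by (auto split: if_splits)
  then show ?thesis
    unfolding path_times_def
    by (intro order_trans[OF keys_sum] UN_least *)
qed

lemma path_times_one:
  assumes "fin_digraph Q" "Poly_Mapping.keys x \<subseteq> qpaths Q"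
  shows "path_times (\<Sum>v\<in>verts Q. path_elem (v, [], v)) x = x"
    and "path_times x (\<Sum>v\<in>verts Q. path_elem (v, [], v)) = x"
proof -
  interpret fin_digraph Q by fact
  have ends: "origin p \<in> verts Q \<and> terminus p \<in> verts Q" if "p \<in> Poly_Mapping.keys x" for p
    using that assms(2) by (auto simp: qpaths_def)
  have single: "path_times (path_elem (v, [], v)) (Poly_Mapping.single p a) =
      (if v = origin p then Poly_Mapping.single p a else 0)"
    for v :: 'a and p :: "('a, 'b) qpath" and a :: 'c
    unfolding path_elem_def path_times_single
    by (cases p) (auto simp: composable_def concat_path_def origin_def terminus_def path_arcs_def)
  have "path_times (\<Sum>v\<in>verts Q. path_elem (v, [], v)) x =
      (\<Sum>p\<in>Poly_Mapping.keys x. \<Sum>v\<in>verts Q.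
        path_times (path_elem (v, [], v)) (Poly_Mapping.single p (Poly_Mapping.lookup x p)))"
    by (subst path_sum_singles[of x])
      (simp only: path_times_sum_left path_times_sum_right sum.swap[of _ "verts Q"])
  also have "\<dots> = (\<Sum>p\<in>Poly_Mapping.keys x. Poly_Mapping.single p (Poly_Mapping.lookup x p))"
    by (intro sum.cong refl) (simp add: single ends)
  also have "\<dots> = x"
    by (rule path_sum_singles[symmetric])
  finally show "path_times (\<Sum>v\<in>verts Q. path_elem (v, [], v)) x = x" .
  have single': "path_times (Poly_Mapping.single p a) (path_elem (v, [], v)) =
      (if v = terminus p then Poly_Mapping.single p a else 0)"
    for v :: 'a and p :: "('a, 'b) qpath" and a :: 'c
    unfolding path_elem_def path_times_single
    by (cases p) (auto simp: composable_def concat_path_def origin_def terminus_def path_arcs_def)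
  have "path_times x (\<Sum>v\<in>verts Q. path_elem (v, [], v)) =
      (\<Sum>p\<in>Poly_Mapping.keys x. \<Sum>v\<in>verts Q.
        path_times (Poly_Mapping.single p (Poly_Mapping.lookup x p)) (path_elem (v, [], v)))"
    by (subst path_sum_singles[of x])
      (simp only: path_times_sum_left path_times_sum_right sum.swap[of _ "verts Q"])
  also have "\<dots> = (\<Sum>p\<in>Poly_Mapping.keys x. Poly_Mapping.single p (Poly_Mapping.lookup x p))"
    by (intro sum.cong refl) (simp add: single' ends)
  also have "\<dots> = x"
    by (rule path_sum_singles[symmetric])
  finally show "path_times x (\<Sum>v\<in>verts Q. path_elem (v, [], v)) = x" .
qed

lemma ring_path_algebra:
  assumes "fin_digraph Q"
  shows "ring (path_algebra Q :: (('v, 'e) qpath \<Rightarrow>\<^sub>0 'k::field) ring)"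
proof -
  interpret fin_digraph Q by fact
  have add: "Poly_Mapping.keys (x + y) \<subseteq> qpaths Q"
    if "Poly_Mapping.keys x \<subseteq> qpaths Q" "Poly_Mapping.keys y \<subseteq> qpaths Q"
    for x y :: "('v, 'e) qpath \<Rightarrow>\<^sub>0 'k"
    using that Poly_Mapping.keys_add[of x y] by blast
  have one: "Poly_Mapping.keys (\<Sum>v\<in>verts Q. path_elem (v, [], v) :: ('v, 'e) qpath \<Rightarrow>\<^sub>0 'k)
      \<subseteq> qpaths Q"
    by (rule order_trans[OF keys_sum])
      (auto simp: path_elem_def qpaths_def origin_def terminus_def path_arcs_def awalk_Nil_iff)
  show ?thesis
  proof (rule ringI)
    show "abelian_group (path_algebra Q :: (('v, 'e) qpath \<Rightarrow>\<^sub>0 'k) ring)"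
    proof (rule abelian_groupI)
      fix x :: "('v, 'e) qpath \<Rightarrow>\<^sub>0 'k" assume "x \<in> carrier (path_algebra Q)"
      then show "\<exists>y\<in>carrier (path_algebra Q). y \<oplus>\<^bsub>path_algebra Q\<^esub> x = \<zero>\<^bsub>path_algebra Q\<^esub>"
        by (intro bexI[of _ "- x"]) (auto simp: path_algebra_def)
    qed (simp_all add: path_algebra_def add_ac add)
    show "Group.monoid (path_algebra Q :: (('v, 'e) qpath \<Rightarrow>\<^sub>0 'k) ring)"
    proof (rule monoidI, goal_cases)
      case (1 x y)
      then show ?case
        using path_times_closed[OF wf_digraph, of x y] by (simp add: path_algebra_def)
    next
      case 2
      then show ?case using one by (simp add: path_algebra_def)
    next
      case (3 x y z)
      then show ?case by (simp add: path_algebra_def path_times_assoc)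
    qed (simp_all add: path_algebra_def path_times_one[OF assms])
  qed (simp_all add: path_algebra_def path_times_add_left path_times_add_right)
qed

lemma lookup_path_scale: "Poly_Mapping.lookup (path_scale c x) p = c * Poly_Mapping.lookup x p"
  by (simp add: path_scale_def Poly_Mapping.map.rep_eq when_def)

lemma vector_space_path_scale: "vector_space path_scale"
  by unfold_locales
    (auto intro!: poly_mapping_eqI simp: lookup_path_scale lookup_add algebra_simps)

lemma path_span_eq_keys: "path_span S = {x. Poly_Mapping.keys x \<subseteq> S}"
proof -
  interpret vector_space "path_scale :: 'c \<Rightarrow> (('a, 'b) qpath \<Rightarrow>\<^sub>0 'c) \<Rightarrow> _"
    by (rule vector_space_path_scale)
  have sub: "subspace {x :: ('a, 'b) qpath \<Rightarrow>\<^sub>0 'c. Poly_Mapping.keys x \<subseteq> S}"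
  proof (rule subspaceI)
    fix x y :: "('a, 'b) qpath \<Rightarrow>\<^sub>0 'c"
    assume "x \<in> {x. Poly_Mapping.keys x \<subseteq> S}" "y \<in> {x. Poly_Mapping.keys x \<subseteq> S}"
    then show "x + y \<in> {x. Poly_Mapping.keys x \<subseteq> S}"
      using Poly_Mapping.keys_add[of x y] by blast
  next
    fix c and x :: "('a, 'b) qpath \<Rightarrow>\<^sub>0 'c"
    assume "x \<in> {x. Poly_Mapping.keys x \<subseteq> S}"
    then show "path_scale c x \<in> {x. Poly_Mapping.keys x \<subseteq> S}"
      by (auto simp: in_keys_iff lookup_path_scale subset_iff)
  qed simp
  have "x \<in> span (path_elem ` S)" if "Poly_Mapping.keys x \<subseteq> S" for x :: "('a, 'b) qpath \<Rightarrow>\<^sub>0 'c"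
  proof -
    have "path_scale a (path_elem p) = Poly_Mapping.single p a" for a :: 'c and p :: "('a, 'b) qpath"
      by (rule poly_mapping_eqI) (simp add: lookup_path_scale path_elem_def lookup_single when_def)
    then have "(\<Sum>p\<in>Poly_Mapping.keys x. path_scale (Poly_Mapping.lookup x p) (path_elem p)) = x"
      by (simp only: path_sum_singles[symmetric])
    moreover have "(\<Sum>p\<in>Poly_Mapping.keys x.
        path_scale (Poly_Mapping.lookup x p) (path_elem p)) \<in> span (path_elem ` S)"
      using that by (intro span_sum span_scale span_base) auto
    ultimately show ?thesis by (simp only:)
  qed
  moreover have "span (path_elem ` S) \<subseteq> {x :: ('a, 'b) qpath \<Rightarrow>\<^sub>0 'c. Poly_Mapping.keys x \<subseteq> S}"
    by (rule span_minimal[OF _ sub]) (auto simp: path_elem_def)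
  ultimately show ?thesis by (auto simp: path_span_def)
qed

end

theory Submission
  imports Defs
begin

text \<open>
  Write \<open>g\<^sub>t\<close> for the element \<open>t - (\<Sum>n. c (t, n) n)\<close> attached to \<open>t \<in> T\<close> and \<open>I\<^sub>c\<close> for the ideal
  that these elements generate. Every multiple of an element of \<open>T\<close> is the tip of an element of
  \<open>I\<^sub>c\<close>, and the elements \<open>g\<^sub>t\<close> form the reduced Groebner basis of \<open>I\<^sub>c\<close> exactly when there are no
  other tips (\<open>reduced_groebner_basis_iff_tips\<close>): the tips of an ideal determine the minimal
  generators of its monomial ideal, and \<open>g\<^sub>t\<close> already has the shape demanded of the basis element
  with tip \<open>t\<close>.

  To turn the absence of further tips into equations, rewrite \<open>t\<close> to \<open>\<Sum>n. c (t, n) n\<close> inside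
  paths. Choosing for each path \<open>p\<close> one way of rewriting it, and continuing until only normal paths
  remain, gives a combination \<open>\<rho>\<^sub>p(c)\<close> of normal paths congruent to \<open>p\<close> modulo \<open>I\<^sub>c\<close>. The choices
  depend on \<open>p\<close> alone, not on \<open>c\<close>, so the coefficients of \<open>\<rho>\<^sub>p(c)\<close> are polynomials in \<open>c\<close>
  (\<open>normal_form_exists\<close>). Extend \<open>p \<mapsto> \<rho>\<^sub>p(c)\<close> linearly to a map \<open>L\<close>. There are no further tips if
  and only if \<open>L\<close> vanishes on \<open>I\<^sub>c\<close>, and since the elements \<open>a g\<^sub>t b\<close> with paths \<open>a\<close> and \<open>b\<close> span
  \<open>I\<^sub>c\<close>, this means that
  \<open>\<rho>\<^bsub>atb\<^esub>(c) = (\<Sum>n. c (t, n) \<rho>\<^bsub>anb\<^esub>(c))\<close> whenever \<open>a t b\<close> is a path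
  (\<open>tips_iff_reductions_agree\<close>). Comparing coefficients yields a family of polynomial equations
  in \<open>c\<close>, indexed by \<open>a\<close>, \<open>b\<close>, \<open>t\<close> and a path; it is infinite in general, which the notion of
  an affine variety allows.
\<close>

section \<open>Polynomial functions\<close>

text \<open>Coordinates of normal forms arise by a recursion that adds and multiplies functions of the
  parameters; this predicate lets one track that they are polynomial without handling the
  polynomials themselves.\<close>

definition polynomial_function :: "'x set \<Rightarrow> (('x \<Rightarrow> 'k::field) \<Rightarrow> 'k) \<Rightarrow> bool" where
  "polynomial_function X P \<longleftrightarrow> (\<exists>f. mpoly_vars f \<subseteq> X \<and> (\<forall>c. mpoly_eval c f = P c))"

definition monomial_eval :: "('x \<Rightarrow> 'k::comm_semiring_1) \<Rightarrow> ('x \<Rightarrow>\<^sub>0 nat) \<Rightarrow> 'k" where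
  "monomial_eval c m = (\<Prod>i\<in>Poly_Mapping.keys m. c i ^ Poly_Mapping.lookup m i)"

lemma monomial_eval_superset:
  assumes "finite A" "Poly_Mapping.keys m \<subseteq> A"
  shows "monomial_eval c m = (\<Prod>i\<in>A. c i ^ Poly_Mapping.lookup m i)"
  unfolding monomial_eval_def
  using assms by (intro prod.mono_neutral_left) (auto simp: in_keys_iff)

lemma monomial_eval_add: "monomial_eval c (m + n) = monomial_eval c m * monomial_eval c n"
proof -
  let ?A = "Poly_Mapping.keys m \<union> Poly_Mapping.keys n"
  have "Poly_Mapping.keys (m + n) \<subseteq> ?A" by (rule Poly_Mapping.keys_add)
  then show ?thesis
    by (subst (1 2 3) monomial_eval_superset[where A = ?A])
      (auto simp: lookup_add power_add prod.distrib)
qed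

lemma mpoly_eval_superset:
  assumes "finite A" "Poly_Mapping.keys f \<subseteq> A"
  shows "mpoly_eval c f = (\<Sum>m\<in>A. Poly_Mapping.lookup f m * monomial_eval c m)"
  unfolding mpoly_eval_def monomial_eval_def
  using assms by (intro sum.mono_neutral_left) (auto simp: in_keys_iff)

lemma mpoly_eval_zero: "mpoly_eval c 0 = 0"
  by (simp add: mpoly_eval_def)

lemma mpoly_eval_single: "mpoly_eval c (Poly_Mapping.single m a) = a * monomial_eval c m"
  by (subst mpoly_eval_superset[where A = "{m}"]) auto

lemma mpoly_eval_add: "mpoly_eval c (f + g) = mpoly_eval c f + mpoly_eval c g"
proof -
  let ?A = "Poly_Mapping.keys f \<union> Poly_Mapping.keys g"
  have "Poly_Mapping.keys (f + g) \<subseteq> ?A" by (rule Poly_Mapping.keys_add)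
  then show ?thesis
    by (subst (1 2 3) mpoly_eval_superset[where A = ?A])
      (auto simp: lookup_add distrib_right sum.distrib)
qed

lemma mpoly_eval_sum: "mpoly_eval c (\<Sum>i\<in>A. f i) = (\<Sum>i\<in>A. mpoly_eval c (f i))"
  by (induction A rule: infinite_finite_induct) (simp_all add: mpoly_eval_zero mpoly_eval_add)

lemma mpoly_eval_mult: "mpoly_eval c (f * g) = mpoly_eval c f * mpoly_eval c g"
proof -
  have single: "mpoly_eval c (Poly_Mapping.single m a * Poly_Mapping.single n b) =
      mpoly_eval c (Poly_Mapping.single m a) * mpoly_eval c (Poly_Mapping.single n b)" for m n a b
    by (simp add: mult_single mpoly_eval_single monomial_eval_add algebra_simps)
  show ?thesis
    by (subst (1 2) path_sum_singles[of f], subst (1 2) path_sum_singles[of g])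
      (simp only: sum_product mpoly_eval_sum single)
qed

lemma polynomial_function_const: "polynomial_function X (\<lambda>c. a)"
  unfolding polynomial_function_def
  by (rule exI[of _ "Poly_Mapping.single 0 a"])
    (auto simp: mpoly_vars_def mpoly_eval_single monomial_eval_def)

lemma polynomial_function_var: "i \<in> X \<Longrightarrow> polynomial_function X (\<lambda>c. c i)"
  unfolding polynomial_function_def
  by (rule exI[of _ "Poly_Mapping.single (Poly_Mapping.single i 1) 1"])
    (auto simp: mpoly_vars_def mpoly_eval_single monomial_eval_def)

lemma polynomial_function_add:
  assumes "polynomial_function X P" "polynomial_function X R"
  shows "polynomial_function X (\<lambda>c. P c + R c)"
proof -
  obtain f g where fg: "mpoly_vars f \<subseteq> X" "mpoly_vars g \<subseteq> X"
      "\<And>c. mpoly_eval c f = P c" "\<And>c. mpoly_eval c g = R c"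
    using assms unfolding polynomial_function_def by auto
  have "mpoly_vars (f + g) \<subseteq> X"
    using fg(1,2) Poly_Mapping.keys_add[of f g] unfolding mpoly_vars_def by blast
  then show ?thesis
    unfolding polynomial_function_def using fg by (intro exI[of _ "f + g"]) (simp add: mpoly_eval_add)
qed

lemma polynomial_function_mult:
  assumes "polynomial_function X P" "polynomial_function X R"
  shows "polynomial_function X (\<lambda>c. P c * R c)"
proof -
  obtain f g where fg: "mpoly_vars f \<subseteq> X" "mpoly_vars g \<subseteq> X"
      "\<And>c. mpoly_eval c f = P c" "\<And>c. mpoly_eval c g = R c"
    using assms unfolding polynomial_function_def by auto
  have "mpoly_vars (f * g) \<subseteq> X"
  proof
    fix i assume "i \<in> mpoly_vars (f * g)"
    then obtain m n where "m \<in> Poly_Mapping.keys f" "n \<in> Poly_Mapping.keys g"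
        "i \<in> Poly_Mapping.keys (m + n)"
      unfolding mpoly_vars_def using Poly_Mapping.keys_mult[of f g] by blast
    then show "i \<in> X"
      using fg(1,2) Poly_Mapping.keys_add[of m n] unfolding mpoly_vars_def by blast
  qed
  then show ?thesis
    unfolding polynomial_function_def using fg by (intro exI[of _ "f * g"]) (simp add: mpoly_eval_mult)
qed

lemma polynomial_function_sum:
  assumes "\<And>i. i \<in> A \<Longrightarrow> polynomial_function X (P i)"
  shows "polynomial_function X (\<lambda>c. \<Sum>i\<in>A. P i c)"
  using assms
  by (induction A rule: infinite_finite_induct)
    (simp_all add: polynomial_function_const polynomial_function_add)

lemma polynomial_function_diff:
  assumes "polynomial_function X P" "polynomial_function X R"
  shows "polynomial_function X (\<lambda>c. P c - R c)"
  using polynomial_function_add[OF assms(1)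
      polynomial_function_mult[OF polynomial_function_const[of X "- 1"] assms(2)]]
  by simp

text \<open>This reduces the theorem to describing the set by equations between functions whose
  polynomiality is known from the closure properties above.\<close>

lemma affine_variety_zero_set:
  assumes "\<And>j. j \<in> J \<Longrightarrow> polynomial_function X (P j)"
    and "V = {c \<in> X \<rightarrow>\<^sub>E UNIV. \<forall>j\<in>J. P j c = 0}"
  shows "affine_variety X V"
proof -
  have "\<forall>j\<in>J. \<exists>f. mpoly_vars f \<subseteq> X \<and> (\<forall>c. mpoly_eval c f = P j c)"
    using assms(1) unfolding polynomial_function_def by blast
  then obtain f where "\<forall>j\<in>J. mpoly_vars (f j) \<subseteq> X \<and> (\<forall>c. mpoly_eval c (f j) = P j c)"
    using bchoice[of J "\<lambda>j f. mpoly_vars f \<subseteq> X \<and> (\<forall>c. mpoly_eval c f = P j c)"] by blast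
  then show ?thesis
    unfolding affine_variety_def assms(2) by (intro exI[of _ "f ` J"]) auto
qed


section \<open>Linear algebra in the path algebra\<close>

interpretation path_space: vector_space path_scale
  by (rule vector_space_path_scale)

lemma path_scale_path_elem: "path_scale a (path_elem p) = Poly_Mapping.single p a"
  by (rule poly_mapping_eqI) (simp add: lookup_path_scale path_elem_def lookup_single when_def)

lemma path_scale_single:
  "path_scale a (Poly_Mapping.single p b) = Poly_Mapping.single p (a * b)"
  by (rule poly_mapping_eqI) (simp add: lookup_path_scale lookup_single when_def)

lemma path_elem_expansion:
  "x = (\<Sum>p\<in>Poly_Mapping.keys x. path_scale (Poly_Mapping.lookup x p) (path_elem p))"
  by (simp add: path_scale_path_elem flip: path_sum_singles)

lemma keys_path_scale: "Poly_Mapping.keys (path_scale a x) \<subseteq> Poly_Mapping.keys x"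
  by (auto simp: in_keys_iff lookup_path_scale)

lemma keys_path_elem: "Poly_Mapping.keys (path_elem p :: _ \<Rightarrow>\<^sub>0 'k::field) = {p}"
  by (simp add: path_elem_def)

lemma lookup_path_elem: "Poly_Mapping.lookup (path_elem p) q = (if p = q then 1 else 0)"
  by (simp add: path_elem_def lookup_single when_def)

lemma keys_diff_subset:
  "Poly_Mapping.keys (x - y) \<subseteq> Poly_Mapping.keys x \<union> Poly_Mapping.keys (y :: _ \<Rightarrow>\<^sub>0 'k::field)"
  by (auto simp: in_keys_iff lookup_minus)

lemma path_times_elem:
  "path_times (path_elem p) (path_elem q) =
     (if composable p q then path_elem (concat_path p q) else 0)"
  by (simp add: path_elem_def path_times_single)

lemma path_times_scale_left: "path_times (path_scale a x) y = path_scale a (path_times x y)"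
proof -
  have 1: "path_times (path_scale a (Poly_Mapping.single p b)) (Poly_Mapping.single q d) =
      path_scale a (path_times (Poly_Mapping.single p b) (Poly_Mapping.single q d))"
    for p q :: "('a, 'b) qpath" and b d
    by (simp add: path_times_single path_scale_single mult.assoc)
  show ?thesis
    by (subst (1 2) path_sum_singles[of x], subst (1 2) path_sum_singles[of y])
      (simp only: path_times_sum_left path_times_sum_right path_space.scale_sum_right 1)
qed

lemma path_times_scale_right: "path_times x (path_scale a y) = path_scale a (path_times x y)"
proof -
  have 1: "path_times (Poly_Mapping.single q d) (path_scale a (Poly_Mapping.single p b)) =
      path_scale a (path_times (Poly_Mapping.single q d) (Poly_Mapping.single p b))"
    for p q :: "('a, 'b) qpath" and b d
    by (simp add: path_times_single path_scale_single mult.left_commute)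
  show ?thesis
    by (subst (1 2) path_sum_singles[of x], subst (1 2) path_sum_singles[of y])
      (simp only: path_times_sum_left path_times_sum_right path_space.scale_sum_right 1)
qed

lemma path_times_minus_left: "path_times (- x) y = - path_times x y"
  using path_times_scale_left[of "-1" x y] by simp

lemma path_times_minus_right: "path_times x (- y) = - path_times x y"
  using path_times_scale_right[of x "-1" y] by simp

lemma path_times_diff_left: "path_times (x - z) y = path_times x y - path_times z y"
  using path_times_add_left[of x "- z" y] by (simp add: path_times_minus_left)

lemma path_times_diff_right: "path_times x (y - z) = path_times x y - path_times x z"
  using path_times_add_right[of x y "- z"] by (simp add: path_times_minus_right)

definition linear_extension ::
  "(('v, 'e) qpath \<Rightarrow> (('v, 'e) qpath \<Rightarrow>\<^sub>0 'k::field)) \<Rightarrow> (('v, 'e) qpath \<Rightarrow>\<^sub>0 'k) \<Rightarrow>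
    (('v, 'e) qpath \<Rightarrow>\<^sub>0 'k)" where
  "linear_extension f x = (\<Sum>p\<in>Poly_Mapping.keys x. path_scale (Poly_Mapping.lookup x p) (f p))"

lemma linear_extension_superset:
  assumes "finite A" "Poly_Mapping.keys x \<subseteq> A"
  shows "linear_extension f x = (\<Sum>p\<in>A. path_scale (Poly_Mapping.lookup x p) (f p))"
  unfolding linear_extension_def
  using assms by (intro sum.mono_neutral_left) (auto simp: in_keys_iff)

lemma linear_extension_path_elem: "linear_extension f (path_elem p) = f p"
  by (simp add: linear_extension_def keys_path_elem lookup_path_elem)

lemma linear_extension_zero: "linear_extension f 0 = 0"
  by (simp add: linear_extension_def)

lemma linear_extension_add:
  "linear_extension f (x + y) = linear_extension f x + linear_extension f y"
proof -
  let ?A = "Poly_Mapping.keys x \<union> Poly_Mapping.keys y"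
  have "Poly_Mapping.keys (x + y) \<subseteq> ?A" by (rule Poly_Mapping.keys_add)
  then show ?thesis
    by (subst (1 2 3) linear_extension_superset[where A = ?A])
      (auto simp: lookup_add path_space.scale_left_distrib sum.distrib)
qed

lemma linear_extension_scale: "linear_extension f (path_scale a x) = path_scale a (linear_extension f x)"
  by (subst (1 2) linear_extension_superset[where A = "Poly_Mapping.keys x"])
    (auto simp: keys_path_scale lookup_path_scale path_space.scale_sum_right)

lemma linear_extension_diff:
  "linear_extension f (x - y) = linear_extension f x - linear_extension f y"
  using linear_extension_add[of f x "path_scale (-1) y"]
  unfolding linear_extension_scale by simp

lemma linear_extension_sum:
  "linear_extension f (\<Sum>i\<in>A. g i) = (\<Sum>i\<in>A. linear_extension f (g i))"
  by (induction A rule: infinite_finite_induct)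
    (simp_all add: linear_extension_zero linear_extension_add)


abbreviation wrappable :: "('v, 'e) qpath \<Rightarrow> ('v, 'e) qpath \<Rightarrow> ('v, 'e) qpath \<Rightarrow> bool" where
  "wrappable a p b \<equiv> composable a p \<and> composable p b"

abbreviation wrap_path ::
  "('v, 'e) qpath \<Rightarrow> ('v, 'e) qpath \<Rightarrow> ('v, 'e) qpath \<Rightarrow> ('v, 'e) qpath" where
  "wrap_path a p b \<equiv> concat_path (concat_path a p) b"

definition sandwich ::
  "('v, 'e) qpath \<Rightarrow> ('v, 'e) qpath \<Rightarrow> (('v, 'e) qpath \<Rightarrow>\<^sub>0 'k::field) \<Rightarrow>
    (('v, 'e) qpath \<Rightarrow>\<^sub>0 'k)" where
  "sandwich a b x = path_times (path_times (path_elem a) x) (path_elem b)"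

lemma sandwich_path_elem:
  "sandwich a b (path_elem p) = (if wrappable a p b then path_elem (wrap_path a p b) else 0)"
  by (auto simp: sandwich_def path_times_elem composable_def)

lemma sandwich_diff: "sandwich a b (x - y) = sandwich a b x - sandwich a b y"
  by (simp add: sandwich_def path_times_diff_left path_times_diff_right)

lemma sandwich_scale: "sandwich a b (path_scale u x) = path_scale u (sandwich a b x)"
  by (simp add: sandwich_def path_times_scale_left path_times_scale_right)

lemma sandwich_sum: "sandwich a b (\<Sum>i\<in>A. f i) = (\<Sum>i\<in>A. sandwich a b (f i))"
  by (simp add: sandwich_def path_times_sum_left path_times_sum_right)

lemma sandwich_expansion:
  "sandwich a b x =
     (\<Sum>p\<in>Poly_Mapping.keys x. path_scale (Poly_Mapping.lookup x p) (sandwich a b (path_elem p)))"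
  by (subst (1) path_elem_expansion[of x]) (simp only: sandwich_sum sandwich_scale)

lemma wrap_path_inject:
  assumes "wrappable a p b" "wrappable a q b" "wrap_path a p b = wrap_path a q b"
  shows "p = q"
  using assms
  by (cases p; cases q) (auto simp: concat_path_def composable_def origin_def terminus_def path_arcs_def)

text \<open>Multiplication by fixed paths on both sides is injective on the paths for which the
  product is defined, so coefficients are merely relabelled.\<close>

lemma lookup_sandwich:
  assumes "wrappable a p b"
  shows "Poly_Mapping.lookup (sandwich a b x) (wrap_path a p b) = Poly_Mapping.lookup x p"
proof -
  have summand: "Poly_Mapping.lookup x q *
        Poly_Mapping.lookup (sandwich a b (path_elem q)) (wrap_path a p b) =
      (if q = p then Poly_Mapping.lookup x p else 0)" for q
    using assms wrap_path_inject[of a q b p]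
    by (cases "wrappable a q b") (auto simp: sandwich_path_elem lookup_path_elem)
  have "Poly_Mapping.lookup (sandwich a b x) (wrap_path a p b) =
      (\<Sum>q\<in>Poly_Mapping.keys x. if q = p then Poly_Mapping.lookup x p else 0)"
    by (subst sandwich_expansion) (simp only: lookup_sum lookup_path_scale summand)
  then show ?thesis by (auto simp: in_keys_iff)
qed

lemma keys_sandwich:
  assumes "q \<in> Poly_Mapping.keys (sandwich a b x)"
  obtains p where "p \<in> Poly_Mapping.keys x" "wrappable a p b" "q = wrap_path a p b"
proof -
  have "q \<in> (\<Union>p\<in>Poly_Mapping.keys x. Poly_Mapping.keys
      (path_scale (Poly_Mapping.lookup x p) (sandwich a b (path_elem p))))"
    using assms by (subst (asm) sandwich_expansion) (rule subsetD[OF keys_sum])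
  then obtain p where "p \<in> Poly_Mapping.keys x" "q \<in> Poly_Mapping.keys
      (path_scale (Poly_Mapping.lookup x p) (sandwich a b (path_elem p)))"
    by blast
  then show ?thesis
    using that subsetD[OF keys_path_scale] by (fastforce simp: sandwich_path_elem keys_path_elem split: if_splits)
qed

text \<open>A two-sided product of arbitrary elements is a combination of sandwiches, so bilinear
  identities need only be checked between paths.\<close>

lemma path_times_eq_sum_sandwich:
  "path_times (path_times x z) y =
     (\<Sum>a\<in>Poly_Mapping.keys x. \<Sum>b\<in>Poly_Mapping.keys y.
        path_scale (Poly_Mapping.lookup x a) (path_scale (Poly_Mapping.lookup y b) (sandwich a b z)))"
  by (subst (1) path_elem_expansion[of x], subst (1) path_elem_expansion[of y])
    (simp only: path_times_sum_left path_times_sum_right path_times_scale_left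
      path_times_scale_right sandwich_def path_space.scale_sum_right
      path_space.scale_left_commute, rule sum.swap)


section \<open>Paths, multiples and tips\<close>

text \<open>These paths span the monomial ideal generated by \<open>S\<close>.\<close>

definition multiples ::
  "('v, 'e) pre_digraph \<Rightarrow> ('v, 'e) qpath set \<Rightarrow> ('v, 'e) qpath set" where
  "multiples Q S = {q \<in> qpaths Q. \<exists>s\<in>S. subpath Q s q}"

lemma normal_paths_eq: "normal_paths Q T = qpaths Q - multiples Q T"
  by (auto simp: normal_paths_def multiples_def)

locale path_order = fin_digraph Q for Q :: "('v, 'e) pre_digraph" +
  fixes r :: "('v, 'e) qpath rel"
  assumes admissible: "admissible_order Q r"
begin

lemma wrap_path_in_qpaths:
  assumes "a \<in> qpaths Q" "p \<in> qpaths Q" "b \<in> qpaths Q" "wrappable a p b"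
  shows "wrap_path a p b \<in> qpaths Q"
  using assms by (intro concat_path_in_qpaths wf_digraph) (auto simp: composable_def)

lemma subpath_refl: "p \<in> qpaths Q \<Longrightarrow> subpath Q p p"
  unfolding subpath_def
  by (rule bexI[of _ "(origin p, [], origin p)"], rule bexI[of _ "(terminus p, [], terminus p)"])
    (auto simp: qpaths_def composable_def concat_path_def origin_def terminus_def path_arcs_def
      awalk_Nil_iff)

lemma subpath_trans:
  assumes "subpath Q p q" "subpath Q q s"
  shows "subpath Q p s"
proof -
  obtain a b where ab: "a \<in> qpaths Q" "b \<in> qpaths Q" "wrappable a p b" "q = wrap_path a p b"
    using assms(1) unfolding subpath_def by blast
  obtain a' b' where ab': "a' \<in> qpaths Q" "b' \<in> qpaths Q" "wrappable a' q b'" "s = wrap_path a' q b'"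
    using assms(2) unfolding subpath_def by blast
  have c: "composable a' a" "composable b b'"
    using ab(3,4) ab'(3) by (auto simp: composable_def)
  show ?thesis
    unfolding subpath_def
  proof (rule bexI[of _ "concat_path a' a"], rule bexI[of _ "concat_path b b'"], intro conjI)
    show "concat_path a' a \<in> qpaths Q" "concat_path b b' \<in> qpaths Q"
      using ab ab' c by (auto intro: concat_path_in_qpaths wf_digraph)
    show "composable (concat_path a' a) p" "composable p (concat_path b b')"
      using ab(3) by (auto simp: composable_def)
    show "s = wrap_path (concat_path a' a) p (concat_path b b')"
      by (simp add: ab(4) ab'(4) concat_path_assoc)
  qed
qed

lemma order_properties:
  "refl_on (qpaths Q) r" "trans r" "antisym r" "total_on (qpaths Q) r"
  using admissible
  by (simp_all add: admissible_order_def well_order_on_def linear_order_on_def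
      partial_order_on_def preorder_on_def)

lemma path_order_refl: "p \<in> qpaths Q \<Longrightarrow> (p, p) \<in> r"
  using order_properties(1) by (rule refl_onD)

lemma path_order_trans: "(p, q) \<in> r \<Longrightarrow> (q, s) \<in> r \<Longrightarrow> (p, s) \<in> r"
  using order_properties(2) by (rule transD)

lemma path_order_antisym: "(p, q) \<in> r \<Longrightarrow> (q, p) \<in> r \<Longrightarrow> p = q"
  using order_properties(3) by (rule antisymD)

lemma path_order_total:
  assumes "p \<in> qpaths Q" "q \<in> qpaths Q"
  shows "(p, q) \<in> r \<or> (q, p) \<in> r"
proof (cases "p = q")
  case True
  then show ?thesis using assms path_order_refl by simp
next
  case False
  then show ?thesis using assms order_properties(4) unfolding total_on_def by simp
qed

lemma path_order_wf: "wf (r - Id)"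
  using admissible unfolding admissible_order_def well_order_on_def by blast

lemma subpath_order: "p \<in> qpaths Q \<Longrightarrow> q \<in> qpaths Q \<Longrightarrow> subpath Q p q \<Longrightarrow> (p, q) \<in> r"
  using admissible unfolding admissible_order_def by blast

lemma subpath_antisym:
  "p \<in> qpaths Q \<Longrightarrow> q \<in> qpaths Q \<Longrightarrow> subpath Q p q \<Longrightarrow> subpath Q q p \<Longrightarrow> p = q"
  using subpath_order path_order_antisym by blast

lemma wrap_path_mono:
  assumes "a \<in> qpaths Q" "p \<in> qpaths Q" "q \<in> qpaths Q" "b \<in> qpaths Q"
    and "wrappable a p b" "wrappable a q b" "path_gt r p q"
  shows "path_gt r (wrap_path a p b) (wrap_path a q b)"
proof -
  have ap: "concat_path a p \<in> qpaths Q" "concat_path a q \<in> qpaths Q"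
    using assms by (auto intro: concat_path_in_qpaths wf_digraph)
  have "path_gt r (concat_path a p) (concat_path a q)"
    using assms admissible unfolding admissible_order_def by blast
  moreover have "composable (concat_path a p) b" "composable (concat_path a q) b"
    using assms by (auto simp: composable_def)
  ultimately show ?thesis
    using ap assms(4) admissible unfolding admissible_order_def by blast
qed

lemma tip_eqI:
  assumes "p \<in> Poly_Mapping.keys x" "\<And>q. q \<in> Poly_Mapping.keys x \<Longrightarrow> (q, p) \<in> r"
  shows "tip r x = p"
  unfolding tip_def using assms path_order_antisym by (intro the_equality) blast+

lemma greatest_path:
  assumes "finite A" "A \<noteq> {}" "A \<subseteq> qpaths Q"
  shows "\<exists>p\<in>A. \<forall>q\<in>A. (q, p) \<in> r"
  using assms
proof (induction A rule: finite_ne_induct)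
  case (singleton p)
  then show ?case using path_order_refl by blast
next
  case (insert p A)
  then obtain m where m: "m \<in> A" "\<forall>q\<in>A. (q, m) \<in> r" by auto
  then consider "(p, m) \<in> r" | "(m, p) \<in> r"
    using path_order_total[of p m] insert.prems by blast
  then show ?case
  proof cases
    case 1
    then show ?thesis using m by blast
  next
    case 2
    then show ?thesis using m insert.prems path_order_trans path_order_refl by blast
  qed
qed

lemma tip_greatest:
  assumes "x \<noteq> 0" "Poly_Mapping.keys x \<subseteq> qpaths Q"
  shows "tip r x \<in> Poly_Mapping.keys x" "\<And>q. q \<in> Poly_Mapping.keys x \<Longrightarrow> (q, tip r x) \<in> r"
proof -
  obtain p where "p \<in> Poly_Mapping.keys x" "\<forall>q\<in>Poly_Mapping.keys x. (q, p) \<in> r"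
    using greatest_path[of "Poly_Mapping.keys x"] assms by auto
  then show "tip r x \<in> Poly_Mapping.keys x" "\<And>q. q \<in> Poly_Mapping.keys x \<Longrightarrow> (q, tip r x) \<in> r"
    using tip_eqI by metis+
qed

lemma tip_path_elem: "p \<in> qpaths Q \<Longrightarrow> tip r (path_elem p :: _ \<Rightarrow>\<^sub>0 'k::field) = p"
  by (rule tip_eqI) (auto simp: keys_path_elem path_order_refl)

text \<open>The compatibility of the order with products carries over to tips: the paths below the tip
  that survive the multiplication stay below its image.\<close>

lemma tip_sandwich:
  assumes "x \<noteq> 0" "Poly_Mapping.keys x \<subseteq> qpaths Q" "a \<in> qpaths Q" "b \<in> qpaths Q"
    and w: "wrappable a (tip r x) b"
  shows "tip r (sandwich a b x) = wrap_path a (tip r x) b" "sandwich a b x \<noteq> 0"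
proof -
  have key: "wrap_path a (tip r x) b \<in> Poly_Mapping.keys (sandwich a b x)"
    using tip_greatest(1)[OF assms(1,2)] by (simp add: in_keys_iff lookup_sandwich[OF w])
  then show "sandwich a b x \<noteq> 0" by auto
  have tip: "tip r x \<in> qpaths Q" using tip_greatest(1)[OF assms(1,2)] assms(2) by blast
  show "tip r (sandwich a b x) = wrap_path a (tip r x) b"
  proof (rule tip_eqI[OF key])
    fix q assume "q \<in> Poly_Mapping.keys (sandwich a b x)"
    then obtain p where p: "p \<in> Poly_Mapping.keys x" "wrappable a p b" "q = wrap_path a p b"
      by (rule keys_sandwich)
    show "(q, wrap_path a (tip r x) b) \<in> r"
    proof (cases "p = tip r x")
      case True
      then show ?thesis using p tip w assms(3,4) by (auto intro!: path_order_refl wrap_path_in_qpaths)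
    next
      case False
      then have "path_gt r (tip r x) p"
        using tip_greatest(2)[OF assms(1,2) p(1)] by (auto simp: path_gt_def)
      moreover have "p \<in> qpaths Q" using p(1) assms(2) by blast
      ultimately show ?thesis
        using wrap_path_mono[of a "tip r x" p b] p w tip assms(3,4) by (simp add: path_gt_def)
    qed
  qed
qed


section \<open>Ideals of the path algebra\<close>

lemma carrier_path_algebra: "x \<in> carrier (path_algebra Q) \<longleftrightarrow> Poly_Mapping.keys x \<subseteq> qpaths Q"
  by (simp add: path_algebra_def)

lemma ring_path: "ring (path_algebra Q :: (('v, 'e) qpath \<Rightarrow>\<^sub>0 'k::field) ring)"
  by (rule ring_path_algebra) (rule fin_digraph_axioms)

lemma path_algebra_idealI:
  fixes I :: "(('v, 'e) qpath \<Rightarrow>\<^sub>0 'k::field) set"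
  assumes carrier: "\<And>x. x \<in> I \<Longrightarrow> Poly_Mapping.keys x \<subseteq> qpaths Q"
    and zero: "0 \<in> I" and add: "\<And>x y. x \<in> I \<Longrightarrow> y \<in> I \<Longrightarrow> x + y \<in> I"
    and left: "\<And>x y. x \<in> I \<Longrightarrow> Poly_Mapping.keys y \<subseteq> qpaths Q \<Longrightarrow> path_times y x \<in> I"
    and right: "\<And>x y. x \<in> I \<Longrightarrow> Poly_Mapping.keys y \<subseteq> qpaths Q \<Longrightarrow> path_times x y \<in> I"
  shows "ideal I (path_algebra Q)"
proof (rule idealI[OF ring_path])
  interpret A: ring "path_algebra Q :: (('v, 'e) qpath \<Rightarrow>\<^sub>0 'k) ring" by (rule ring_path)
  let ?A = "path_algebra Q :: (('v, 'e) qpath \<Rightarrow>\<^sub>0 'k) ring"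
  \<comment> \<open>An additive inverse is the product with \<open>-1\<close>.\<close>
  have neg: "\<ominus>\<^bsub>?A\<^esub> x \<in> I" if "x \<in> I" for x
  proof -
    have x: "x \<in> carrier ?A" using carrier[OF that] by (simp add: carrier_path_algebra)
    have "\<ominus>\<^bsub>?A\<^esub> x = (\<ominus>\<^bsub>?A\<^esub> \<one>\<^bsub>?A\<^esub>) \<otimes>\<^bsub>?A\<^esub> x"
      using x by (simp add: A.l_minus)
    moreover have "\<dots> \<in> I"
      using left[OF that, of "\<ominus>\<^bsub>?A\<^esub> \<one>\<^bsub>?A\<^esub>"] A.a_inv_closed[OF A.one_closed]
      by (simp add: carrier_path_algebra) (simp add: path_algebra_def)
    ultimately show ?thesis by simp
  qed
  show "subgroup I (add_monoid ?A)"
    using neg zero by (intro A.add.subgroupI) (auto simp: path_algebra_def a_inv_def add dest: carrier)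
qed (auto simp: path_algebra_def intro: left right)

context
  fixes I :: "(('v, 'e) qpath \<Rightarrow>\<^sub>0 'k::field) set"
  assumes I: "ideal I (path_algebra Q)"
begin

interpretation ideal I "path_algebra Q" by (rule I)

lemma ideal_carrier: "x \<in> I \<Longrightarrow> Poly_Mapping.keys x \<subseteq> qpaths Q"
  using a_subset by (auto simp: path_algebra_def)

lemma ideal_zero: "0 \<in> I"
  using additive_subgroup.zero_closed[OF is_additive_subgroup] by (simp add: path_algebra_def)

lemma ideal_add: "x \<in> I \<Longrightarrow> y \<in> I \<Longrightarrow> x + y \<in> I"
  using additive_subgroup.a_closed[OF is_additive_subgroup] by (simp add: path_algebra_def)

lemma ideal_sandwich: "x \<in> I \<Longrightarrow> a \<in> qpaths Q \<Longrightarrow> b \<in> qpaths Q \<Longrightarrow> sandwich a b x \<in> I"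
  using I_r_closed[of "path_times (path_elem a) x" "path_elem b"] I_l_closed[of x "path_elem a"]
  by (simp add: sandwich_def path_algebra_def keys_path_elem)

lemma ideal_scale: "x \<in> I \<Longrightarrow> path_scale u x \<in> I"
proof -
  assume x: "x \<in> I"
  let ?A = "path_algebra Q :: (('v, 'e) qpath \<Rightarrow>\<^sub>0 'k) ring"
  have one: "Poly_Mapping.keys (\<one>\<^bsub>?A\<^esub>) \<subseteq> qpaths Q"
    using one_closed by (simp add: carrier_path_algebra)
  have "path_scale u \<one>\<^bsub>?A\<^esub> \<in> carrier ?A"
    unfolding carrier_path_algebra using one keys_path_scale by blast
  then have "path_times (path_scale u \<one>\<^bsub>?A\<^esub>) x \<in> I"
    using I_l_closed[OF x] by (simp add: path_algebra_def)
  moreover have "path_times \<one>\<^bsub>?A\<^esub> x = x"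
    using path_times_one(1)[OF fin_digraph_axioms ideal_carrier[OF x]] by (simp add: path_algebra_def)
  ultimately show ?thesis by (simp add: path_times_scale_left)
qed

lemma ideal_diff: "x \<in> I \<Longrightarrow> y \<in> I \<Longrightarrow> x - y \<in> I"
  using ideal_add[of x "path_scale (-1) y"] ideal_scale[of y "-1"] by simp

lemma ideal_sum: "(\<And>i. i \<in> A \<Longrightarrow> f i \<in> I) \<Longrightarrow> (\<Sum>i\<in>A. f i) \<in> I"
  by (induction A rule: infinite_finite_induct) (auto intro: ideal_zero ideal_add)

lemma tips_subset: "tips r I \<subseteq> qpaths Q"
proof -
  have "tip r x \<in> qpaths Q" if "x \<in> I" "x \<noteq> 0" for x
    using tip_greatest(1)[OF that(2) ideal_carrier[OF that(1)]] ideal_carrier[OF that(1)] by blast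
  then show ?thesis unfolding tips_def image_subset_iff Diff_iff by simp
qed

text \<open>Tips are closed under taking multiples, hence the monomial ideal of \<open>I\<close> is spanned by
  the tips of \<open>I\<close> themselves.\<close>

lemma tips_subpath:
  assumes "p \<in> tips r I" "subpath Q p q"
  shows "q \<in> tips r I"
proof -
  obtain x where x: "x \<in> I" "x \<noteq> 0" "p = tip r x"
    using assms(1) by (auto simp: tips_def)
  obtain a b where ab: "a \<in> qpaths Q" "b \<in> qpaths Q" "wrappable a p b" "q = wrap_path a p b"
    using assms(2) unfolding subpath_def by blast
  have "tip r (sandwich a b x) = q" "sandwich a b x \<noteq> 0"
    using tip_sandwich[OF x(2) ideal_carrier[OF x(1)] ab(1,2)] ab(3,4) x(3) by auto
  then show ?thesis
    using ideal_sandwich[OF x(1) ab(1,2)] by (auto simp: tips_def)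
qed

lemma ideal_eq_zero:
  assumes "x \<in> I" "Poly_Mapping.keys x \<inter> tips r I = {}"
  shows "x = 0"
  using assms tip_greatest(1)[OF _ ideal_carrier] by (force simp: tips_def)

text \<open>Subtracting a multiple of an element of \<open>I\<close> with tip \<open>p\<close> replaces \<open>p\<close> by smaller paths, so
  reduction terminates because the order is well-founded.\<close>

lemma ideal_remainder:
  assumes "p \<in> qpaths Q"
  shows "\<exists>g\<in>I. Poly_Mapping.keys (path_elem p - g) \<subseteq> qpaths Q - tips r I"
  using assms
proof (induction p rule: wf_induct_rule[OF path_order_wf])
  case (1 p)
  show ?case
  proof (cases "p \<in> tips r I")
    case False
    then show ?thesis using 1(2) by (intro bexI[OF _ ideal_zero]) (auto simp: keys_path_elem)
  next
    case True
    then obtain y where y: "y \<in> I" "y \<noteq> 0" "p = tip r y" by (auto simp: tips_def)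
    let ?u = "Poly_Mapping.lookup y p"
    have u: "?u \<noteq> 0"
      using tip_greatest(1)[OF y(2) ideal_carrier[OF y(1)]] y(3) by (simp add: in_keys_iff)
    define x where "x = path_elem p - path_scale (1 / ?u) y"
    have x_p: "Poly_Mapping.lookup x p = 0"
      using u by (simp add: x_def lookup_minus lookup_path_elem lookup_path_scale)
    have IH: "\<exists>g\<in>I. Poly_Mapping.keys (path_elem q - g) \<subseteq> qpaths Q - tips r I"
      if "q \<in> Poly_Mapping.keys x" for q
    proof (rule 1(1))
      have "q \<noteq> p" using that x_p by (auto simp: in_keys_iff)
      then have "q \<in> Poly_Mapping.keys y"
        using that by (auto simp: in_keys_iff x_def lookup_minus lookup_path_elem lookup_path_scale)
      then show "(q, p) \<in> r - Id" "q \<in> qpaths Q"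
        using tip_greatest(2)[OF y(2) ideal_carrier[OF y(1)]] y(3) \<open>q \<noteq> p\<close> ideal_carrier[OF y(1)]
        by auto
    qed
    then obtain g where g: "\<And>q. q \<in> Poly_Mapping.keys x \<Longrightarrow> g q \<in> I"
        "\<And>q. q \<in> Poly_Mapping.keys x \<Longrightarrow>
          Poly_Mapping.keys (path_elem q - g q) \<subseteq> qpaths Q - tips r I"
      by metis
    define s where
      "s = (\<Sum>q\<in>Poly_Mapping.keys x. path_scale (Poly_Mapping.lookup x q) (g q))"
    define h where "h = path_scale (1 / ?u) y + s"
    have "path_elem p - h = x - s"
      by (simp add: x_def h_def)
    also have "\<dots> =
        (\<Sum>q\<in>Poly_Mapping.keys x. path_scale (Poly_Mapping.lookup x q) (path_elem q - g q))"
      unfolding s_def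
      by (subst (1) path_elem_expansion[of x])
        (simp only: path_space.scale_right_diff_distrib sum_subtractf)
    finally have eq: "path_elem p - h = \<dots>" .
    have "Poly_Mapping.keys (path_elem p - h) \<subseteq> qpaths Q - tips r I"
      unfolding eq
      using g(2) by (intro order_trans[OF keys_sum] UN_least order_trans[OF keys_path_scale])
    moreover have "h \<in> I"
      unfolding h_def s_def using y(1) g(1) by (intro ideal_add ideal_scale ideal_sum)
    ultimately show ?thesis by blast
  qed
qed

text \<open>Two candidates for \<^const>\<open>groebner_elem\<close> differ by an element of \<open>I\<close> that involves no tip
  of \<open>I\<close>, and such an element is zero.\<close>

lemma groebner_elem_eqI:
  assumes "g \<in> I" "Poly_Mapping.keys (path_elem p - g) \<subseteq> qpaths Q - tips r I"
  shows "groebner_elem Q r I p = g"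
  unfolding groebner_elem_def path_span_eq_keys mem_Collect_eq
proof (rule the_equality)
  show "g \<in> I \<and> Poly_Mapping.keys (path_elem p - g) \<subseteq> qpaths Q - tips r I"
    using assms by blast
next
  fix h assume h: "h \<in> I \<and> Poly_Mapping.keys (path_elem p - h) \<subseteq> qpaths Q - tips r I"
  have "g - h = (path_elem p - h) - (path_elem p - g)" by simp
  then have "Poly_Mapping.keys (g - h) \<subseteq> qpaths Q - tips r I"
    using keys_diff_subset[of "path_elem p - h" "path_elem p - g"] assms(2) h by auto
  then show "h = g"
    using ideal_eq_zero[of "g - h"] ideal_diff[of g h] assms(1) h by auto
qed

text \<open>In \<open>p - g\<close> no tip of \<open>I\<close> occurs, so \<open>p\<close> is the only tip of \<open>I\<close> among the paths of \<open>g\<close>;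
  the tip of \<open>g\<close> is one of them.\<close>

lemma tip_groebner_elem:
  assumes p: "p \<in> tips r I"
  shows "tip r (groebner_elem Q r I p) = p"
proof -
  have pQ: "p \<in> qpaths Q" using p tips_subset by blast
  obtain g where g: "g \<in> I" "Poly_Mapping.keys (path_elem p - g) \<subseteq> qpaths Q - tips r I"
    using ideal_remainder[OF pQ] by blast
  have other: "q \<notin> tips r I" if "q \<in> Poly_Mapping.keys g" "q \<noteq> p" for q
  proof -
    have "q \<in> Poly_Mapping.keys (path_elem p - g)"
      using that by (simp add: in_keys_iff lookup_minus lookup_path_elem)
    then show ?thesis using g(2) by blast
  qed
  have "p \<notin> Poly_Mapping.keys (path_elem p - g)" using g(2) p by blast
  then have "g \<noteq> 0" by (auto simp: keys_path_elem)
  then have "tip r g \<in> tips r I" "tip r g \<in> Poly_Mapping.keys g"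
    using g(1) tip_greatest(1)[OF _ ideal_carrier] by (auto simp: tips_def)
  then have "tip r g = p" using other by blast
  then show ?thesis using groebner_elem_eqI[OF g] by simp
qed

end


section \<open>Monomial ideals\<close>

lemma multiples_self: "S \<subseteq> qpaths Q \<Longrightarrow> S \<subseteq> multiples Q S"
  unfolding multiples_def using subpath_refl by blast

lemma multiples_idem: "multiples Q (multiples Q S) = multiples Q S"
  using subpath_trans subpath_refl unfolding multiples_def by blast

lemma subpath_concat:
  assumes "p \<in> qpaths Q" "q \<in> qpaths Q" "composable p q"
  shows "subpath Q p (concat_path p q)" "subpath Q q (concat_path p q)"
proof -
  have triv: "(origin p, [], origin p) \<in> qpaths Q" "(terminus q, [], terminus q) \<in> qpaths Q"
    using assms by (auto simp: qpaths_def origin_def terminus_def path_arcs_def awalk_Nil_iff)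
  have "concat_path p q = wrap_path (origin p, [], origin p) p q"
      "concat_path p q = wrap_path p q (terminus q, [], terminus q)"
    by (auto simp: concat_path_def origin_def terminus_def path_arcs_def)
  moreover have "wrappable (origin p, [], origin p) p q" "wrappable p q (terminus q, [], terminus q)"
    using assms(3) by (auto simp: composable_def origin_def terminus_def)
  ultimately show "subpath Q p (concat_path p q)" "subpath Q q (concat_path p q)"
    unfolding subpath_def using assms triv by blast+
qed

lemma keys_path_times:
  assumes "q \<in> Poly_Mapping.keys (path_times x y)"
  obtains a b where "a \<in> Poly_Mapping.keys x" "b \<in> Poly_Mapping.keys y" "composable a b"
    "q = concat_path a b"
proof -
  have "q \<in> (\<Union>a\<in>Poly_Mapping.keys x. \<Union>b\<in>Poly_Mapping.keys y. Poly_Mapping.keys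
      (if composable a b then Poly_Mapping.single (concat_path a b)
        (Poly_Mapping.lookup x a * Poly_Mapping.lookup y b) else 0))"
    using assms unfolding path_times_def
    by (rule rev_subsetD) (intro order_trans[OF keys_sum] UN_mono order_refl keys_sum)
  then show ?thesis using that by (auto split: if_splits)
qed

lemma genideal_path_elems:
  assumes S: "S \<subseteq> qpaths Q"
  shows "genideal (path_algebra Q) (path_elem ` S :: (_ \<Rightarrow>\<^sub>0 'k::field) set) =
    {x. Poly_Mapping.keys x \<subseteq> multiples Q S}" (is "?L = ?R")
proof
  interpret A: ring "path_algebra Q :: (('v, 'e) qpath \<Rightarrow>\<^sub>0 'k) ring" by (rule ring_path)
  have gens: "path_elem ` S \<subseteq> carrier (path_algebra Q :: (('v, 'e) qpath \<Rightarrow>\<^sub>0 'k) ring)"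
    using S by (auto simp: carrier_path_algebra keys_path_elem)
  have "ideal ?R (path_algebra Q)"
  proof (rule path_algebra_idealI)
    fix x y :: "('v, 'e) qpath \<Rightarrow>\<^sub>0 'k"
    assume x: "x \<in> ?R"
    then show "Poly_Mapping.keys x \<subseteq> qpaths Q" by (auto simp: multiples_def)
    show "x + y \<in> ?R" if "y \<in> ?R"
      using that x Poly_Mapping.keys_add[of x y] by blast
    assume y: "Poly_Mapping.keys y \<subseteq> qpaths Q"
    have xp: "p \<in> qpaths Q \<and> (\<exists>s\<in>S. subpath Q s p)" if "p \<in> Poly_Mapping.keys x" for p
      using x that by (auto simp: multiples_def)
    show "path_times y x \<in> ?R"
    proof (intro CollectI subsetI)
      fix q assume "q \<in> Poly_Mapping.keys (path_times y x)"
      then obtain a b where ab: "a \<in> Poly_Mapping.keys y" "b \<in> Poly_Mapping.keys x"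
          "composable a b" "q = concat_path a b"
        by (rule keys_path_times)
      then have "a \<in> qpaths Q" "b \<in> qpaths Q" using xp y by blast+
      then have "subpath Q b q" "q \<in> qpaths Q"
        unfolding ab(4) using ab(3)
        by (simp_all add: subpath_concat concat_path_in_qpaths[OF wf_digraph])
      then show "q \<in> multiples Q S"
        using xp[OF ab(2)] subpath_trans unfolding multiples_def by blast
    qed
    show "path_times x y \<in> ?R"
    proof (intro CollectI subsetI)
      fix q assume "q \<in> Poly_Mapping.keys (path_times x y)"
      then obtain a b where ab: "a \<in> Poly_Mapping.keys x" "b \<in> Poly_Mapping.keys y"
          "composable a b" "q = concat_path a b"
        by (rule keys_path_times)
      then have "a \<in> qpaths Q" "b \<in> qpaths Q" using xp y by blast+
      then have "subpath Q a q" "q \<in> qpaths Q"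
        unfolding ab(4) using ab(3)
        by (simp_all add: subpath_concat concat_path_in_qpaths[OF wf_digraph])
      then show "q \<in> multiples Q S"
        using xp[OF ab(1)] subpath_trans unfolding multiples_def by blast
    qed
  qed simp
  moreover have "path_elem ` S \<subseteq> ?R"
    using multiples_self[OF S] by (auto simp: keys_path_elem)
  ultimately show "?L \<subseteq> ?R" by (rule A.genideal_minimal)
  have L: "ideal ?L (path_algebra Q)" by (rule A.genideal_ideal[OF gens])
  have elem: "path_elem q \<in> ?L" if q: "q \<in> multiples Q S" for q
  proof -
    obtain s where s: "s \<in> S" "subpath Q s q" using q by (auto simp: multiples_def)
    obtain a b where ab: "a \<in> qpaths Q" "b \<in> qpaths Q" "wrappable a s b" "q = wrap_path a s b"
      using s(2) unfolding subpath_def by blast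
    have "path_elem s \<in> ?L" using A.genideal_self[OF gens] s(1) by blast
    from ideal_sandwich[OF L this ab(1,2)] show ?thesis
      using ab(3,4) by (simp add: sandwich_path_elem)
  qed
  show "?R \<subseteq> ?L"
  proof
    fix x :: "('v, 'e) qpath \<Rightarrow>\<^sub>0 'k" assume "x \<in> ?R"
    then show "x \<in> ?L"
      by (subst path_elem_expansion) (auto intro!: ideal_sum[OF L] ideal_scale[OF L] elem)
  qed
qed

definition subpath_free :: "('v, 'e) qpath set \<Rightarrow> bool" where
  "subpath_free S \<longleftrightarrow> (\<forall>s\<in>S. \<forall>s'\<in>S. subpath Q s s' \<longrightarrow> s = s')"

lemma keys_subset_set_eq_iff:
  "{x :: ('v, 'e) qpath \<Rightarrow>\<^sub>0 'k::field. Poly_Mapping.keys x \<subseteq> A} = {x. Poly_Mapping.keys x \<subseteq> B} \<longleftrightarrow> A = B"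
proof
  assume eq: "{x :: ('v, 'e) qpath \<Rightarrow>\<^sub>0 'k. Poly_Mapping.keys x \<subseteq> A} = {x. Poly_Mapping.keys x \<subseteq> B}"
  have "p \<in> A \<longleftrightarrow> p \<in> B" for p
    using arg_cong[OF eq, of "\<lambda>Z. path_elem p \<in> Z"] by (simp add: keys_path_elem)
  then show "A = B" by blast
qed simp

text \<open>Any set of paths that generates the same monomial ideal as the subpath-free set \<open>S\<close>
  contains \<open>S\<close>: an element \<open>s\<close> of \<open>S\<close> is a multiple of some generator \<open>p\<close>, which is a multiple of
  some element of \<open>S\<close>; the latter can only be \<open>s\<close>, so \<open>p = s\<close>.\<close>

lemma minimal_path_generators_iff:
  assumes S: "S \<subseteq> qpaths Q" "subpath_free S"
  shows "minimal_path_generators Q {x :: _ \<Rightarrow>\<^sub>0 'k::field. Poly_Mapping.keys x \<subseteq> multiples Q S} S'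
    \<longleftrightarrow> S' = S"
proof -
  have gen: "genideal (path_algebra Q) (path_elem ` R :: (_ \<Rightarrow>\<^sub>0 'k) set) =
      {x. Poly_Mapping.keys x \<subseteq> multiples Q S} \<longleftrightarrow> multiples Q R = multiples Q S"
    if "R \<subseteq> qpaths Q" for R
    unfolding genideal_path_elems[OF that] keys_subset_set_eq_iff ..
  have contains: "S \<subseteq> R" if R: "R \<subseteq> qpaths Q" "multiples Q R = multiples Q S" for R
  proof
    fix s assume s: "s \<in> S"
    then obtain p where p: "p \<in> R" "subpath Q p s"
      using multiples_self[OF S(1)] R(2) unfolding multiples_def by blast
    then obtain s' where s': "s' \<in> S" "subpath Q s' p"
      using multiples_self[OF R(1)] R(2) unfolding multiples_def by blast
    then have "s' = s"
      using S(2) s subpath_trans[OF s'(2) p(2)] unfolding subpath_free_def by blast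
    then have "p = s" using subpath_antisym[of p s] p s' s R(1) S(1) by blast
    then show "s \<in> R" using p(1) by simp
  qed
  have "minimal_path_generators Q {x :: _ \<Rightarrow>\<^sub>0 'k. Poly_Mapping.keys x \<subseteq> multiples Q S} S' \<longleftrightarrow>
      S' \<subseteq> qpaths Q \<and> multiples Q S' = multiples Q S \<and>
      (\<forall>R. R \<subset> S' \<longrightarrow> multiples Q R \<noteq> multiples Q S)"
  proof (cases "S' \<subseteq> qpaths Q")
    case True
    then have "R \<subset> S' \<Longrightarrow> R \<subseteq> qpaths Q" for R by blast
    then show ?thesis
      using True by (simp add: minimal_path_generators_def gen cong: imp_cong)
  qed (simp add: minimal_path_generators_def)
  also have "\<dots> \<longleftrightarrow> S' = S"
    using contains S(1) by blast
  finally show ?thesis .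
qed

lemma min_tips_eqI:
  fixes I :: "(('v, 'e) qpath \<Rightarrow>\<^sub>0 'k::field) set"
  assumes I: "ideal I (path_algebra Q)" and S: "S \<subseteq> qpaths Q" "subpath_free S"
    and tips: "tips r I = multiples Q S"
  shows "min_tips Q r I = S"
proof -
  have "mon_ideal Q r I = {x. Poly_Mapping.keys x \<subseteq> multiples Q S}"
    unfolding mon_ideal_def genideal_path_elems[OF tips_subset[OF I]]
    by (simp add: tips multiples_idem)
  then show ?thesis
    unfolding min_tips_def by (intro the_equality) (simp_all add: minimal_path_generators_iff[OF S])
qed

text \<open>Since proper subpaths are smaller in the well-order, every tip has a subpath that is
  minimal among the tips, and the minimal tips form a subpath-free set to which
  \<open>min_tips_eqI\<close> applies.\<close>

lemma multiples_min_tips: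
  fixes I :: "(('v, 'e) qpath \<Rightarrow>\<^sub>0 'k::field) set"
  assumes I: "ideal I (path_algebra Q)"
  shows "multiples Q (min_tips Q r I) = tips r I" "min_tips Q r I \<subseteq> tips r I"
proof -
  let ?U = "tips r I"
  define M where "M = {p \<in> ?U. \<forall>q\<in>?U. subpath Q q p \<longrightarrow> q = p}"
  have U: "?U \<subseteq> qpaths Q" by (rule tips_subset[OF I])
  have below: "\<exists>m\<in>M. subpath Q m p" if "p \<in> ?U" for p
    using that
  proof (induction p rule: wf_induct_rule[OF path_order_wf])
    case (1 p)
    show ?case
    proof (cases "p \<in> M")
      case True
      then show ?thesis using subpath_refl U 1(2) by blast
    next
      case False
      then obtain q where q: "q \<in> ?U" "subpath Q q p" "q \<noteq> p"
        using 1(2) unfolding M_def by blast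
      then have "(q, p) \<in> r - Id" using subpath_order U 1(2) by blast
      then show ?thesis using 1(1) q subpath_trans by blast
    qed
  qed
  have "multiples Q M = ?U"
    using below tips_subpath[OF I] U unfolding multiples_def M_def by blast
  moreover have "M \<subseteq> qpaths Q" "subpath_free M" "M \<subseteq> ?U"
    using U unfolding M_def subpath_free_def by blast+
  ultimately show "multiples Q (min_tips Q r I) = ?U" "min_tips Q r I \<subseteq> ?U"
    using min_tips_eqI[OF I, of M] by simp_all
qed

lemma subpath_free_if_tip_reduced:
  assumes "tip_reduced Q r (path_elem ` T :: (_ \<Rightarrow>\<^sub>0 'k::field) set)" "T \<subseteq> qpaths Q"
  shows "subpath_free T"
  unfolding subpath_free_def
proof (intro ballI impI)
  fix s t assume st: "s \<in> T" "t \<in> T" "subpath Q s t"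
  have tip: "tip r (path_elem p :: _ \<Rightarrow>\<^sub>0 'k) = p" "(path_elem p :: _ \<Rightarrow>\<^sub>0 'k) \<noteq> 0" if "p \<in> T" for p
    using that assms(2) tip_path_elem[of p] keys_path_elem[where ?'k = 'k, of p] by auto
  have "(path_elem s :: _ \<Rightarrow>\<^sub>0 'k) = path_elem t"
  proof (rule ccontr)
    assume "(path_elem s :: _ \<Rightarrow>\<^sub>0 'k) \<noteq> path_elem t"
    then have "\<not> subpath Q (tip r (path_elem s :: _ \<Rightarrow>\<^sub>0 'k)) (tip r (path_elem t :: _ \<Rightarrow>\<^sub>0 'k))"
      using assms(1) st(1,2) tip(2) unfolding tip_reduced_def by blast
    then show False using st(3) by (simp add: tip(1)[OF st(1)] tip(1)[OF st(2)])
  qed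
  from arg_cong[OF this, of "tip r"] show "s = t"
    by (simp only: tip(1)[OF st(1)] tip(1)[OF st(2)])
qed

end


section \<open>Normal forms modulo a family of relations\<close>

locale tip_set = path_order Q r for Q :: "('v, 'e) pre_digraph" and r +
  fixes T :: "('v, 'e) qpath set"
  assumes T_paths: "T \<subseteq> qpaths Q"
    and T_free: "subpath_free T"
begin

definition relation ::
  "(('v, 'e) qpath \<times> ('v, 'e) qpath \<Rightarrow> 'k::field) \<Rightarrow> ('v, 'e) qpath \<Rightarrow> (('v, 'e) qpath \<Rightarrow>\<^sub>0 'k)" where
  "relation c t = path_elem t - (\<Sum>n\<in>normal_below Q r T t. path_scale (c (t, n)) (path_elem n))"

abbreviation relation_ideal ::
  "(('v, 'e) qpath \<times> ('v, 'e) qpath \<Rightarrow> 'k::field) \<Rightarrow> (('v, 'e) qpath \<Rightarrow>\<^sub>0 'k) set" where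
  "relation_ideal c \<equiv> genideal (path_algebra Q) (G_of Q r T c)"

lemma G_of_eq: "G_of Q r T c = relation c ` T"
  by (simp add: G_of_def relation_def)

lemma normal_belowD:
  assumes "n \<in> normal_below Q r T t"
  shows "n \<in> qpaths Q" "n \<in> normal_paths Q T" "path_gt r t n"
  using assms by (auto simp: normal_below_def normal_paths_def)

text \<open>This is where it matters that \<open>n\<close> is parallel to \<open>t\<close>: replacing \<open>t\<close> by \<open>n\<close> inside a path
  gives a path again.\<close>

lemma wrappable_normal_below:
  "n \<in> normal_below Q r T t \<Longrightarrow> wrappable a n b \<longleftrightarrow> wrappable a t b"
  by (auto simp: normal_below_def parallel_def composable_def)

lemma wrap_normal_below:
  assumes "n \<in> normal_below Q r T t" "t \<in> T" "a \<in> qpaths Q" "b \<in> qpaths Q" "wrappable a t b"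
  shows "wrap_path a n b \<in> qpaths Q" "(wrap_path a n b, wrap_path a t b) \<in> r - Id"
  using assms T_paths normal_belowD[OF assms(1)] wrappable_normal_below[OF assms(1)]
    wrap_path_mono[of a t n b] wrap_path_in_qpaths
  by (auto simp: path_gt_def)

lemma keys_tail:
  "Poly_Mapping.keys (path_elem t - relation c t) \<subseteq> normal_below Q r T t"
proof -
  have "path_elem t - relation c t = (\<Sum>n\<in>normal_below Q r T t. path_scale (c (t, n)) (path_elem n))"
    by (simp add: relation_def)
  also have "Poly_Mapping.keys \<dots> \<subseteq>
      (\<Union>n\<in>normal_below Q r T t. Poly_Mapping.keys (path_scale (c (t, n)) (path_elem n)))"
    by (rule keys_sum)
  also have "\<dots> \<subseteq> normal_below Q r T t"
  proof (rule UN_least)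
    fix n assume "n \<in> normal_below Q r T t"
    then show "Poly_Mapping.keys (path_scale (c (t, n)) (path_elem n)) \<subseteq> normal_below Q r T t"
      using keys_path_scale[of "c (t, n)" "path_elem n"] by (auto simp only: keys_path_elem)
  qed
  finally show ?thesis .
qed

lemma keys_relation: "Poly_Mapping.keys (relation c t) \<subseteq> insert t (normal_below Q r T t)"
proof -
  have "relation c t = path_elem t - (path_elem t - relation c t)" by simp
  then show ?thesis
    using keys_diff_subset[of "path_elem t" "path_elem t - relation c t"] keys_tail[of t c]
    by (auto simp: keys_path_elem)
qed

lemma keys_relation_qpaths: "t \<in> T \<Longrightarrow> Poly_Mapping.keys (relation c t) \<subseteq> qpaths Q"
  using keys_relation[of c t] normal_belowD(1) T_paths by blast

lemma tip_relation:
  assumes "t \<in> T"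
  shows "tip r (relation c t) = t" "relation c t \<noteq> 0"
proof -
  have "t \<notin> Poly_Mapping.keys (path_elem t - relation c t)"
    using keys_tail[of t c] normal_belowD(3)[of t t] by (auto simp: path_gt_def)
  then have t: "t \<in> Poly_Mapping.keys (relation c t)"
    by (simp add: in_keys_iff lookup_minus lookup_path_elem)
  then show "relation c t \<noteq> 0" by auto
  show "tip r (relation c t) = t"
  proof (rule tip_eqI[OF t])
    fix q assume "q \<in> Poly_Mapping.keys (relation c t)"
    then show "(q, t) \<in> r"
      using keys_relation[of c t] normal_belowD(3)[of q t] path_order_refl[of t] T_paths assms
      by (auto simp: path_gt_def)
  qed
qed

lemma sandwich_relation:
  "sandwich a b (relation c t) =
    (if wrappable a t b
     then path_elem (wrap_path a t b) -
       (\<Sum>n\<in>normal_below Q r T t. path_scale (c (t, n)) (path_elem (wrap_path a n b)))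
     else 0)"
proof -
  have "sandwich a b (relation c t) = sandwich a b (path_elem t) -
      (\<Sum>n\<in>normal_below Q r T t. path_scale (c (t, n)) (sandwich a b (path_elem n)))"
    by (simp only: relation_def sandwich_diff sandwich_sum sandwich_scale)
  also have "(\<Sum>n\<in>normal_below Q r T t. path_scale (c (t, n)) (sandwich a b (path_elem n))) =
      (\<Sum>n\<in>normal_below Q r T t. path_scale (c (t, n))
        (if wrappable a t b then path_elem (wrap_path a n b) else 0))"
    by (intro sum.cong refl) (simp only: sandwich_path_elem wrappable_normal_below)
  finally show ?thesis by (cases "wrappable a t b") (auto simp: sandwich_path_elem)
qed

lemma relations_carrier: "G_of Q r T c \<subseteq> carrier (path_algebra Q)"
  unfolding G_of_eq image_subset_iff carrier_path_algebra using keys_relation_qpaths by blast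

lemma ideal_relation_ideal: "ideal (relation_ideal c) (path_algebra Q)"
  by (rule ring.genideal_ideal[OF ring_path relations_carrier])

lemma relation_in_ideal: "t \<in> T \<Longrightarrow> relation c t \<in> relation_ideal c"
  using ring.genideal_self[OF ring_path relations_carrier[of c]] by (auto simp: G_of_eq)

lemma multiples_subset_tips: "multiples Q T \<subseteq> tips r (relation_ideal c)"
proof
  fix q assume "q \<in> multiples Q T"
  then obtain t where t: "t \<in> T" "subpath Q t q" by (auto simp: multiples_def)
  have "t \<in> tips r (relation_ideal c)"
    using tip_relation[OF t(1), of c] relation_in_ideal[OF t(1), of c] unfolding tips_def by force
  then show "q \<in> tips r (relation_ideal c)"
    by (rule tips_subpath[OF ideal_relation_ideal _ t(2)])
qed

text \<open>From left to right, comparing the tips of the two sets shows that \<open>T\<close> is the set of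
  minimal tips, and these generate all tips. From right to left, the minimal tips are the elements
  of \<open>T\<close>, and each \<^term>\<open>relation c t\<close> satisfies the defining property of the basis element with
  tip \<open>t\<close>, because the paths in its tail are not multiples of elements of \<open>T\<close> and hence are
  no tips.\<close>

lemma reduced_groebner_basis_iff_tips:
  "G_of Q r T c = reduced_groebner_basis Q r (relation_ideal c) \<longleftrightarrow>
    tips r (relation_ideal c) \<subseteq> multiples Q T"
proof
  let ?I = "relation_ideal c"
  note I = ideal_relation_ideal[of c]
  {
    assume basis: "G_of Q r T c = reduced_groebner_basis Q r ?I"
    have "tip r ` G_of Q r T c = T"
      using tip_relation(1)[of _ c] by (force simp: G_of_eq)
    moreover have "tip r ` reduced_groebner_basis Q r ?I = min_tips Q r ?I"
      using tip_groebner_elem[OF I] multiples_min_tips(2)[OF I]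
      unfolding reduced_groebner_basis_def image_image by force
    ultimately have "min_tips Q r ?I = T" using basis by simp
    then show "tips r ?I \<subseteq> multiples Q T"
      using multiples_min_tips(1)[OF I] by simp
  next
    assume "tips r ?I \<subseteq> multiples Q T"
    then have tips: "tips r ?I = multiples Q T"
      using multiples_subset_tips[of c] by blast
    have "groebner_elem Q r ?I t = relation c t" if t: "t \<in> T" for t
    proof (rule groebner_elem_eqI[OF I relation_in_ideal[OF t]])
      show "Poly_Mapping.keys (path_elem t - relation c t) \<subseteq> qpaths Q - tips r ?I"
        using keys_tail[of t c] normal_belowD(2) unfolding tips normal_paths_eq by blast
    qed
    then have "groebner_elem Q r ?I ` T = relation c ` T"
      by (intro image_cong refl)
    then show "G_of Q r T c = reduced_groebner_basis Q r ?I"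
      unfolding reduced_groebner_basis_def min_tips_eqI[OF I T_paths T_free tips]
      by (simp only: G_of_eq)
  }
qed

text \<open>The function \<open>\<rho>\<close> gives a remainder of \<open>p\<close> for every choice \<open>c\<close> of the parameters at once, which
  allows the coefficients to be polynomial in \<open>c\<close>. The remainder is not assumed to be unique:
  different orders of rewriting may give different functions. The bound by \<open>p\<close> keeps a path from
  contributing to the coefficients of larger normal paths.\<close>

definition normal_form ::
  "('v, 'e) qpath \<Rightarrow> ((('v, 'e) qpath \<times> ('v, 'e) qpath \<Rightarrow> 'k::field) \<Rightarrow> (('v, 'e) qpath \<Rightarrow>\<^sub>0 'k))
    \<Rightarrow> bool" where
  "normal_form p \<rho> \<longleftrightarrow>
    (\<forall>c. path_elem p - \<rho> c \<in> relation_ideal c) \<and>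
    (\<forall>c. Poly_Mapping.keys (\<rho> c) \<subseteq> {q \<in> normal_paths Q T. (q, p) \<in> r}) \<and>
    (\<forall>q. polynomial_function (coord_index Q r T) (\<lambda>c. Poly_Mapping.lookup (\<rho> c) q)) \<and>
    (p \<in> normal_paths Q T \<longrightarrow> (\<forall>c. \<rho> c = path_elem p))"

text \<open>A path \<open>p = a t b\<close> is congruent to \<open>\<Sum>n. c (t, n) a n b\<close>, where all the paths \<open>a n b\<close> are
  smaller than \<open>p\<close>. The decomposition of \<open>p\<close> is fixed before \<open>c\<close> is given, so one step of the
  recursion only multiplies polynomials by variables and adds the results.\<close>

lemma normal_form_exists:
  assumes "p \<in> qpaths Q"
  shows "\<exists>\<rho> :: _ \<Rightarrow> (_ \<Rightarrow>\<^sub>0 'k::field). normal_form p \<rho>"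
  using assms
proof (induction p rule: wf_induct_rule[OF path_order_wf])
  case (1 p)
  show ?case
  proof (cases "p \<in> normal_paths Q T")
    case True
    have "normal_form p (\<lambda>c. path_elem p :: _ \<Rightarrow>\<^sub>0 'k)"
      using True path_order_refl[OF 1(2)]
      by (simp add: normal_form_def keys_path_elem polynomial_function_const
          ideal_zero[OF ideal_relation_ideal])
    then show ?thesis by blast
  next
    case False
    then obtain t where t: "t \<in> T" "subpath Q t p"
      using 1(2) by (auto simp: normal_paths_def)
    obtain a b where ab: "a \<in> qpaths Q" "b \<in> qpaths Q" "wrappable a t b" "p = wrap_path a t b"
      using t(2) unfolding subpath_def by blast
    let ?N = "normal_below Q r T t"
    have smaller: "(wrap_path a n b, p) \<in> r" if "n \<in> ?N" for n
      using wrap_normal_below[OF that t(1) ab(1-3)] ab(4) by simp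
    have "\<forall>n\<in>?N. \<exists>\<rho> :: _ \<Rightarrow> (_ \<Rightarrow>\<^sub>0 'k). normal_form (wrap_path a n b) \<rho>"
      using 1(1) wrap_normal_below[OF _ t(1) ab(1-3)] ab(4) by blast
    then obtain \<sigma> :: "_ \<Rightarrow> _ \<Rightarrow> (_ \<Rightarrow>\<^sub>0 'k)"
      where \<sigma>: "\<And>n. n \<in> ?N \<Longrightarrow> normal_form (wrap_path a n b) (\<sigma> n)"
      by metis
    define \<rho> where "\<rho> c = (\<Sum>n\<in>?N. path_scale (c (t, n)) (\<sigma> n c))" for c
    have "path_elem p - \<rho> c \<in> relation_ideal c" for c
    proof -
      have "path_elem p - \<rho> c = sandwich a b (relation c t) +
          (\<Sum>n\<in>?N. path_scale (c (t, n)) (path_elem (wrap_path a n b) - \<sigma> n c))"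
        using ab(3,4)
        by (simp add: \<rho>_def sandwich_relation path_space.scale_right_diff_distrib sum_subtractf)
      also have "\<dots> \<in> relation_ideal c"
        using \<sigma> unfolding normal_form_def
        by (intro ideal_add ideal_sum ideal_scale ideal_sandwich ideal_relation_ideal
            relation_in_ideal t(1) ab(1,2)) blast
      finally show ?thesis .
    qed
    moreover have "Poly_Mapping.keys (\<rho> c) \<subseteq> {q \<in> normal_paths Q T. (q, p) \<in> r}" for c
      unfolding \<rho>_def
    proof (intro order_trans[OF keys_sum] UN_least order_trans[OF keys_path_scale])
      fix n assume n: "n \<in> ?N"
      then have "Poly_Mapping.keys (\<sigma> n c) \<subseteq> {q \<in> normal_paths Q T. (q, wrap_path a n b) \<in> r}"
        using \<sigma> unfolding normal_form_def by blast
      then show "Poly_Mapping.keys (\<sigma> n c) \<subseteq> {q \<in> normal_paths Q T. (q, p) \<in> r}"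
        using path_order_trans[OF _ smaller[OF n]] by blast
    qed
    moreover have "polynomial_function (coord_index Q r T) (\<lambda>c. Poly_Mapping.lookup (\<rho> c) q)" for q
      unfolding \<rho>_def lookup_sum lookup_path_scale
    proof (intro polynomial_function_sum polynomial_function_mult polynomial_function_var)
      fix n assume n: "n \<in> ?N"
      then show "(t, n) \<in> coord_index Q r T" using t(1) by (simp add: coord_index_def)
      show "polynomial_function (coord_index Q r T) (\<lambda>c. Poly_Mapping.lookup (\<sigma> n c) q)"
        using \<sigma>[OF n] unfolding normal_form_def by blast
    qed
    ultimately have "normal_form p \<rho>"
      using False unfolding normal_form_def by blast
    then show ?thesis by blast
  qed
qed

text \<open>If only multiples of \<open>T\<close> are tips, the difference of the two sides is an element of the
  ideal that is a combination of normal paths, hence zero. Conversely, the equations say that the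
  linear extension \<open>L\<close> of \<open>nf\<close> kills all sandwiches of relations and hence the whole ideal. Were
  the tip \<open>p\<close> of some \<open>x\<close> in the ideal normal, the coefficient of \<open>p\<close> in \<open>L x\<close> would be that in
  \<open>x\<close>: \<open>p\<close> is its own normal form, and those of the smaller paths in \<open>x\<close> cannot contain \<open>p\<close>.\<close>

lemma tips_iff_reductions_agree:
  fixes nf :: "('v, 'e) qpath \<Rightarrow> (('v, 'e) qpath \<times> ('v, 'e) qpath \<Rightarrow> 'k::field) \<Rightarrow> _"
  assumes nf: "\<And>p. p \<in> qpaths Q \<Longrightarrow> normal_form p (nf p)"
  shows "tips r (relation_ideal c) \<subseteq> multiples Q T \<longleftrightarrow>
    (\<forall>a\<in>qpaths Q. \<forall>b\<in>qpaths Q. \<forall>t\<in>T. wrappable a t b \<longrightarrow>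
      nf (wrap_path a t b) c =
        (\<Sum>n\<in>normal_below Q r T t. path_scale (c (t, n)) (nf (wrap_path a n b) c)))"
    (is "?tips \<longleftrightarrow> ?agree")
proof
  let ?I = "relation_ideal c"
  note I = ideal_relation_ideal[of c]
  have nf_ideal: "path_elem p - nf p c \<in> ?I" if "p \<in> qpaths Q" for p
    using nf[OF that] unfolding normal_form_def by blast
  have nf_keys: "q \<in> normal_paths Q T \<and> (q, p) \<in> r"
    if "p \<in> qpaths Q" "q \<in> Poly_Mapping.keys (nf p c)" for p q
    using nf[OF that(1)] that(2) unfolding normal_form_def by blast
  {
    assume tips: ?tips
    show ?agree
    proof (intro ballI impI)
      fix a b t assume ab: "a \<in> qpaths Q" "b \<in> qpaths Q" and t: "t \<in> T" and w: "wrappable a t b"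
      let ?N = "normal_below Q r T t"
      let ?s = "\<Sum>n\<in>?N. path_scale (c (t, n)) (nf (wrap_path a n b) c)"
      note aNb = wrap_normal_below[OF _ t ab w]
      have atb: "wrap_path a t b \<in> qpaths Q"
        using wrap_path_in_qpaths ab t w T_paths by blast
      have "nf (wrap_path a t b) c - ?s = sandwich a b (relation c t) -
          (path_elem (wrap_path a t b) - nf (wrap_path a t b) c) +
          (\<Sum>n\<in>?N. path_scale (c (t, n)) (path_elem (wrap_path a n b) - nf (wrap_path a n b) c))"
        using w by (simp add: sandwich_relation path_space.scale_right_diff_distrib sum_subtractf)
      also have "\<dots> \<in> ?I"
        by (intro ideal_add[OF I] ideal_diff[OF I] ideal_sum[OF I] ideal_scale[OF I]
            ideal_sandwich[OF I] relation_in_ideal nf_ideal t ab atb aNb)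
      finally have "nf (wrap_path a t b) c - ?s \<in> ?I" .
      moreover have "Poly_Mapping.keys ?s \<subseteq> normal_paths Q T"
        using nf_keys[OF aNb(1)]
        by (intro order_trans[OF keys_sum] UN_least order_trans[OF keys_path_scale]) blast
      then have "Poly_Mapping.keys (nf (wrap_path a t b) c - ?s) \<subseteq> normal_paths Q T"
        using keys_diff_subset[of "nf (wrap_path a t b) c" ?s] nf_keys[OF atb] by blast
      then have "Poly_Mapping.keys (nf (wrap_path a t b) c - ?s) \<inter> tips r ?I = {}"
        using tips unfolding normal_paths_eq by blast
      ultimately have "nf (wrap_path a t b) c - ?s = 0" by (rule ideal_eq_zero[OF I])
      then show "nf (wrap_path a t b) c = ?s" by simp
    qed
  next
    assume agree: ?agree
    define L where "L = linear_extension (\<lambda>p. nf p c)"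
    \<comment> \<open>The kernel of \<open>L\<close> need not be an ideal; \<open>K\<close> is the largest ideal contained in it.\<close>
    define K where "K = {x. Poly_Mapping.keys x \<subseteq> qpaths Q \<and>
      (\<forall>u v. Poly_Mapping.keys u \<subseteq> qpaths Q \<longrightarrow> Poly_Mapping.keys v \<subseteq> qpaths Q \<longrightarrow>
        L (path_times (path_times u x) v) = 0)}"
    have K: "ideal K (path_algebra Q)"
    proof (rule path_algebra_idealI)
      fix x y assume x: "x \<in> K"
      show keys_x: "Poly_Mapping.keys x \<subseteq> qpaths Q" using x by (simp add: K_def)
      show "x + y \<in> K" if "y \<in> K"
        using x that Poly_Mapping.keys_add[of x y]
        by (auto simp: K_def L_def path_times_add_left path_times_add_right linear_extension_add)
      assume y: "Poly_Mapping.keys y \<subseteq> qpaths Q"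
      have "L (path_times (path_times u (path_times y x)) v) = 0"
          "L (path_times (path_times u (path_times x y)) v) = 0"
        if uv: "Poly_Mapping.keys u \<subseteq> qpaths Q" "Poly_Mapping.keys v \<subseteq> qpaths Q" for u v
      proof -
        have "path_times (path_times u (path_times y x)) v = path_times (path_times (path_times u y) x) v"
            "path_times (path_times u (path_times x y)) v = path_times (path_times u x) (path_times y v)"
          by (simp_all add: path_times_assoc)
        moreover have "Poly_Mapping.keys (path_times u y) \<subseteq> qpaths Q"
            "Poly_Mapping.keys (path_times y v) \<subseteq> qpaths Q"
          using uv y by (simp_all add: path_times_closed[OF wf_digraph])
        ultimately show "L (path_times (path_times u (path_times y x)) v) = 0"
            "L (path_times (path_times u (path_times x y)) v) = 0"
          using x uv by (simp_all add: K_def)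
      qed
      then show "path_times y x \<in> K" "path_times x y \<in> K"
        using path_times_closed[OF wf_digraph keys_x y] path_times_closed[OF wf_digraph y keys_x]
        by (simp_all add: K_def)
    qed (auto simp: K_def L_def linear_extension_zero)
    have "relation c t \<in> K" if t: "t \<in> T" for t
    proof -
      have zero: "L (sandwich a b (relation c t)) = 0" if ab: "a \<in> qpaths Q" "b \<in> qpaths Q" for a b
        using agree t ab
        by (simp add: sandwich_relation L_def linear_extension_zero linear_extension_diff
            linear_extension_sum linear_extension_scale linear_extension_path_elem)
      have "L (path_times (path_times u (relation c t)) v) = 0"
        if "Poly_Mapping.keys u \<subseteq> qpaths Q" "Poly_Mapping.keys v \<subseteq> qpaths Q" for u v
      proof -
        have "L (path_times (path_times u (relation c t)) v) =
            (\<Sum>a\<in>Poly_Mapping.keys u. \<Sum>b\<in>Poly_Mapping.keys v.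
              path_scale (Poly_Mapping.lookup u a)
                (path_scale (Poly_Mapping.lookup v b) (L (sandwich a b (relation c t)))))"
          by (simp only: path_times_eq_sum_sandwich L_def linear_extension_sum linear_extension_scale)
        also have "\<dots> = 0"
          by (intro sum.neutral ballI)
            (simp add: zero[OF subsetD[OF that(1)] subsetD[OF that(2)]])
        finally show ?thesis .
      qed
      then show ?thesis using keys_relation_qpaths[OF t] by (simp add: K_def)
    qed
    then have "G_of Q r T c \<subseteq> K" by (auto simp: G_of_eq)
    then have sub: "?I \<subseteq> K" by (rule ring.genideal_minimal[OF ring_path K])
    have L_zero: "L x = 0" if x: "x \<in> ?I" for x
    proof -
      let ?one = "\<Sum>v\<in>verts Q. path_elem (v, [], v) :: _ \<Rightarrow>\<^sub>0 'k"
      have "Poly_Mapping.keys ?one \<subseteq> qpaths Q"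
        using monoid.one_closed[OF ring.is_monoid[OF ring_path[where ?'k = 'k]]]
        by (simp add: path_algebra_def)
      moreover have "path_times (path_times ?one x) ?one = x"
        using path_times_one[OF fin_digraph_axioms ideal_carrier[OF I x]] by simp
      ultimately show ?thesis using sub x unfolding K_def by force
    qed
    show ?tips
    proof
      fix p assume "p \<in> tips r ?I"
      then obtain x where x: "x \<in> ?I" "x \<noteq> 0" "p = tip r x" by (auto simp: tips_def)
      note xQ = ideal_carrier[OF I x(1)]
      have p: "p \<in> Poly_Mapping.keys x" "\<And>q. q \<in> Poly_Mapping.keys x \<Longrightarrow> (q, p) \<in> r"
        using tip_greatest[OF x(2) xQ] x(3) by auto
      show "p \<in> multiples Q T"
      proof (rule ccontr)
        assume "p \<notin> multiples Q T"
        then have normal: "p \<in> normal_paths Q T" using p(1) xQ unfolding normal_paths_eq by blast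
        have "Poly_Mapping.lookup (nf q c) p = (if q = p then 1 else 0)"
          if q: "q \<in> Poly_Mapping.keys x" for q
        proof (cases "q = p")
          case True
          then show ?thesis
            using nf[of p] normal xQ q unfolding normal_form_def by (auto simp: lookup_path_elem)
        next
          case False
          then have "p \<notin> Poly_Mapping.keys (nf q c)"
            using nf_keys[of q p] p(2)[OF q] q xQ path_order_antisym by blast
          then show ?thesis using False by (simp add: in_keys_iff)
        qed
        then have "Poly_Mapping.lookup (L x) p =
            (\<Sum>q\<in>Poly_Mapping.keys x. if q = p then Poly_Mapping.lookup x p else 0)"
          unfolding L_def linear_extension_def lookup_sum lookup_path_scale
          by (intro sum.cong refl) simp
        then have "Poly_Mapping.lookup (L x) p = Poly_Mapping.lookup x p"
          using p(1) by simp
        then show False using L_zero[OF x(1)] p(1) by (simp add: in_keys_iff)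
      qed
    qed
  }
qed

lemma affine_variety_V_of:
  "affine_variety (coord_index Q r T)
     (V_of Q r T :: (('v, 'e) qpath \<times> ('v, 'e) qpath \<Rightarrow> 'k::field) set)"
proof -
  have "\<forall>p\<in>qpaths Q. \<exists>\<rho> :: _ \<Rightarrow> (_ \<Rightarrow>\<^sub>0 'k). normal_form p \<rho>"
    using normal_form_exists by blast
  then obtain nf :: "_ \<Rightarrow> _ \<Rightarrow> (_ \<Rightarrow>\<^sub>0 'k)" where nf: "\<And>p. p \<in> qpaths Q \<Longrightarrow> normal_form p (nf p)"
    by metis
  define J where "J = {(a, b, t, q :: ('v, 'e) qpath).
    a \<in> qpaths Q \<and> b \<in> qpaths Q \<and> t \<in> T \<and> wrappable a t b}"
  define P where "P = (\<lambda>(a, b, t, q) c. Poly_Mapping.lookup (nf (wrap_path a t b) c) q -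
    (\<Sum>n\<in>normal_below Q r T t. c (t, n) * Poly_Mapping.lookup (nf (wrap_path a n b) c) q))"
  have nf_poly: "polynomial_function (coord_index Q r T) (\<lambda>c. Poly_Mapping.lookup (nf p c) q)"
    if "p \<in> qpaths Q" for p q
    using nf[OF that] unfolding normal_form_def by blast
  show ?thesis
  proof (rule affine_variety_zero_set)
    fix j assume "j \<in> J"
    then obtain a b t q where j: "j = (a, b, t, q)" "a \<in> qpaths Q" "b \<in> qpaths Q" "t \<in> T"
        "wrappable a t b"
      unfolding J_def by blast
    have "wrap_path a t b \<in> qpaths Q" using wrap_path_in_qpaths j T_paths by blast
    then show "polynomial_function (coord_index Q r T) (P j)"
      unfolding P_def j(1) prod.case
      using wrap_normal_below(1)[OF _ j(4,2,3,5)] j(4)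
      by (intro polynomial_function_diff polynomial_function_sum polynomial_function_mult
          polynomial_function_var nf_poly) (auto simp: coord_index_def)
  next
    have zeros: "(\<forall>j\<in>J. P j c = 0) \<longleftrightarrow> (\<forall>a\<in>qpaths Q. \<forall>b\<in>qpaths Q. \<forall>t\<in>T. wrappable a t b \<longrightarrow>
        nf (wrap_path a t b) c =
          (\<Sum>n\<in>normal_below Q r T t. path_scale (c (t, n)) (nf (wrap_path a n b) c)))" for c
    proof (intro iffI ballI impI)
      fix a b t
      assume P: "\<forall>j\<in>J. P j c = 0"
        and abt: "a \<in> qpaths Q" "b \<in> qpaths Q" "t \<in> T" "wrappable a t b"
      show "nf (wrap_path a t b) c =
          (\<Sum>n\<in>normal_below Q r T t. path_scale (c (t, n)) (nf (wrap_path a n b) c))"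
      proof (rule poly_mapping_eqI)
        fix q
        have "(a, b, t, q) \<in> J" using abt by (simp add: J_def)
        then have "P (a, b, t, q) c = 0" using P by blast
        then show "Poly_Mapping.lookup (nf (wrap_path a t b) c) q = Poly_Mapping.lookup
            (\<Sum>n\<in>normal_below Q r T t. path_scale (c (t, n)) (nf (wrap_path a n b) c)) q"
          by (simp add: P_def lookup_sum lookup_path_scale)
      qed
    next
      fix j
      assume agree: "\<forall>a\<in>qpaths Q. \<forall>b\<in>qpaths Q. \<forall>t\<in>T. wrappable a t b \<longrightarrow>
          nf (wrap_path a t b) c =
            (\<Sum>n\<in>normal_below Q r T t. path_scale (c (t, n)) (nf (wrap_path a n b) c))"
        and "j \<in> J"
      then obtain a b t q where j: "j = (a, b, t, q)" "a \<in> qpaths Q" "b \<in> qpaths Q" "t \<in> T"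
          "wrappable a t b"
        unfolding J_def by blast
      then have "nf (wrap_path a t b) c =
          (\<Sum>n\<in>normal_below Q r T t. path_scale (c (t, n)) (nf (wrap_path a n b) c))"
        using agree by blast
      then show "P j c = 0"
        by (simp add: j(1) P_def lookup_sum lookup_path_scale)
    qed
    have "G_of Q r T c = reduced_groebner_basis Q r (relation_ideal c) \<longleftrightarrow> (\<forall>j\<in>J. P j c = 0)" for c
      unfolding reduced_groebner_basis_iff_tips zeros
      by (rule tips_iff_reductions_agree) (rule nf)
    then have "c \<in> V_of Q r T \<longleftrightarrow> c \<in> coord_index Q r T \<rightarrow>\<^sub>E UNIV \<and> (\<forall>j\<in>J. P j c = 0)" for c
      unfolding V_of_def by simp
    then show "V_of Q r T = {c \<in> coord_index Q r T \<rightarrow>\<^sub>E UNIV. \<forall>j\<in>J. P j c = 0}"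
      by blast
  qed
qed

end

theorem theorem4p4:
  fixes Q :: "('v, 'e) pre_digraph"
    and r :: "('v, 'e) qpath rel"
    and T :: "('v, 'e) qpath set"
  assumes "fin_digraph Q"
    and "admissible_order Q r"
    and "T \<subseteq> qpaths Q"
    and "finite T"
    and "tip_reduced Q r (path_elem ` T :: (('v, 'e) qpath \<Rightarrow>\<^sub>0 'k::field) set)"
    and "\<forall>t\<in>T. 2 \<le> path_length t"
    and "\<forall>t\<in>T. finite (normal_below Q r T t)"
  shows "affine_variety (coord_index Q r T)
           (V_of Q r T :: (('v, 'e) qpath \<times> ('v, 'e) qpath \<Rightarrow> 'k) set)"
proof -
  interpret path_order Q r
    using assms(1,2) by (simp add: path_order_def path_order_axioms_def)
  have "tip_set Q r T"
    using assms(3) subpath_free_if_tip_reduced[OF assms(5,3)]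
    by unfold_locales
  then show ?thesis by (rule tip_set.affine_variety_V_of)
qed

end
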